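(* Let $\kappa>\aleph_0$ be a regular cardinal and let $\mathfrak K$ be a category with a partial quasi-limiting operator $\mathcal L$ on $\operatorname{Seq}_{<\kappa}(\mathfrak K)$. Then every two $\mathcal L$-continuous $\kappa$-Fraïssé sequences $\vec u,\vec v$ in $\mathfrak K$ satisfy the back-and-forth principle: for every $\alpha<\kappa$ and every arrow $f\colon u_\alpha\to\vec v$ there exists an isomorphism of sequences $h\colon\vec u\to\vec v$ such that $h\circ u_\alpha^\infty=f$.
   Context: $\mathfrak K(a,b)$ is the set of arrows from $a$ to $b$. An inductive sequence of length $\delta$ ($\delta>0$ an ordinal) in $\mathfrak K$ is a functor $\vec a\colon\delta\to\mathfrak K$, with objects $a_\xi$ and bonding arrows $a_\xi^\eta\colon a_\xi\to a_\eta$ ($\xi\leq\eta<\delta$). A transformation $\vec a\to\vec b$ of sequences (of lengths $\lambda,\rho$) is an order preserving $\varphi\colon\lambda\to\rho$ together with arrows $F(\alpha)\colon a_\alpha\to b_{\varphi(\alpha)}$ satisfying $F(\beta)\circ a_\alpha^\beta=b_{\varphi(\alpha)}^{\varphi(\beta)}\circ F(\alpha)$ for $\alpha\leq\beta$. Transformations $(\varphi,F)$, $(\psi,G)$ are equivalent if for every $\alpha<\lambda$ there is $\gamma\geq\varphi(\alpha),\psi(\alpha)$ with $b_{\varphi(\alpha)}^\gamma\circ F(\alpha)=b_{\psi(\alpha)}^\gamma\circ G(\alpha)$. Arrows of sequences are equivalence classes of transformations. Objects are identified with sequences of length $1$; $u_\alpha^\infty\colon u_\alpha\to\vec u$ is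 the arrow represented by $\mathrm{id}_{u_\alpha}$. $\operatorname{Seq}_{<\kappa}(\mathfrak K)$ is the category of all sequences of length $<\kappa$ with these arrows, and $\operatorname{Seq}^{\mathrm{iso}}_{<\kappa}(\mathfrak K)$ is the category with the same objects and only isomorphisms as arrows. A partial quasi-limiting operator $\mathcal L$ on $\operatorname{Seq}_{<\kappa}(\mathfrak K)$ is a functor defined on an isomorphism-closed class of sequences of length $<\kappa$ (with all isomorphisms between them), assigning to each such $\vec x$, of length $\lambda$, a co-cone $\mathcal L\vec x=(x_\xi^\infty\colon x_\xi\to\bar x)_{\xi<\lambda}$ for $\vec x$ in $\mathfrak K$ (so $x_\eta^\infty\circ x_\xi^\eta=x_\xi^\infty$ for $\xi<\eta$), and assigning functorially to each isomorphism of sequences $\vec h\colon\vec x\to\vec y$ an isomorphism $h_\infty\colon\bar x\to\bar y$ in $\mathfrak K$ commuting with it: whenever $(\varphi,h)$ represents $\vec h$, $h_\infty\circ x_\xi^\infty=y_{\varphi(\xi)}^\infty\circ h_\xi$ for all $\xi$. (If all sequences are in the domain it is a quasi-limiting operator.) A sequence $\vec x$ of length $\rho\leq\kappa$ is $\mathcal L$-continuous if for every limit ordinal $\delta<\rho$, $\mathcal L(\vec x\restriction\delta)$ is defined and $x_\delta$ together with the co-cone $(x_\xi^\delta)_{\xi<\delta}$ is $\mathcal L(\vec x\restriction\delta)$. A $\kappa$-Fraïssé sequence in $\mathfrak K$ is an inductive sequence $\vec u$ of length $\kappa$ such that (U) for every object $x$ there is $\xi<\kappa$ with $\mathfrak K(x,u_\xi)\neq\emptyset$;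 (A) for every $\xi<\kappa$ and every arrow $f\colon u_\xi\to y$ there are $\eta\geq\xi$ and $g\colon y\to u_\eta$ with $u_\xi^\eta=g\circ f$. *)

theory Defs
  imports Main "HOL-Library.FuncSet"
begin

unbundle cardinal_syntax

section \<open>Categories\<close>

record ('o, 'a) cat =
  Obj :: "'o set"
  Arr :: "'a set"
  Dom :: "'a \<Rightarrow> 'o"
  Cod :: "'a \<Rightarrow> 'o"
  Ident :: "'o \<Rightarrow> 'a"
  Comp :: "'a \<Rightarrow> 'a \<Rightarrow> 'a"  (infixl \<open>\<bullet>\<index>\<close> 70)

definition homset :: "('o, 'a) cat \<Rightarrow> 'o \<Rightarrow> 'o \<Rightarrow> 'a set" where
  "homset C a b = {f \<in> Arr C. Dom C f = a \<and> Cod C f = b}"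

definition category :: "('o, 'a) cat \<Rightarrow> bool" where
  "category C \<longleftrightarrow>
     (\<forall>f\<in>Arr C. Dom C f \<in> Obj C \<and> Cod C f \<in> Obj C) \<and>
     (\<forall>a\<in>Obj C. Ident C a \<in> homset C a a) \<and>
     (\<forall>f\<in>Arr C. \<forall>g\<in>Arr C. Cod C f = Dom C g \<longrightarrow>
        g \<bullet>\<^bsub>C\<^esub> f \<in> homset C (Dom C f) (Cod C g)) \<and>
     (\<forall>f\<in>Arr C. f \<bullet>\<^bsub>C\<^esub> Ident C (Dom C f) = f \<and> Ident C (Cod C f) \<bullet>\<^bsub>C\<^esub> f = f) \<and>
     (\<forall>f\<in>Arr C. \<forall>g\<in>Arr C. \<forall>h\<in>Arr C. Cod C f = Dom C g \<longrightarrow> Cod C g = Dom C h \<longrightarrow>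
        h \<bullet>\<^bsub>C\<^esub> (g \<bullet>\<^bsub>C\<^esub> f) = (h \<bullet>\<^bsub>C\<^esub> g) \<bullet>\<^bsub>C\<^esub> f)"

definition isos :: "('o, 'a) cat \<Rightarrow> 'o \<Rightarrow> 'o \<Rightarrow> 'a set" where
  "isos C a b =
     {f \<in> homset C a b. \<exists>g\<in>homset C b a. g \<bullet>\<^bsub>C\<^esub> f = Ident C a \<and> f \<bullet>\<^bsub>C\<^esub> g = Ident C b}"


section \<open>Ordinals up to a cardinal\<close>

text \<open>
  Throughout, \<open>\<kappa> :: 'k rel\<close> is a (reflexive) well-order.  The ordinals below \<open>\<kappa>\<close> are the
  elements of \<open>Field \<kappa>\<close>: the element \<open>\<delta>\<close> stands for the order type of its set
  \<open>underS \<kappa> \<delta>\<close> of strict predecessors.  Hence the ordinals \<open>\<le> \<kappa>\<close>, as sets of smaller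
  ordinals, are exactly the initial segments (\<open>ofilter\<close>) of \<open>\<kappa>\<close>; those \<open>< \<kappa>\<close> are the
  proper ones, and \<open>\<kappa>\<close> itself is \<open>Field \<kappa>\<close>.
\<close>

definition ord_zero :: "'k rel \<Rightarrow> 'k" where
  "ord_zero \<kappa> = wo_rel.minim \<kappa> (Field \<kappa>)"

text \<open>Zero is not counted as a limit (a sequence of length \<open>0\<close> is not a sequence).\<close>

definition limit_ord :: "'k rel \<Rightarrow> 'k \<Rightarrow> bool" where
  "limit_ord \<kappa> \<delta> \<longleftrightarrow> \<delta> \<in> Field \<kappa> \<and> underS \<kappa> \<delta> \<noteq> {} \<and>
     (\<forall>\<xi>\<in>underS \<kappa> \<delta>. \<exists>\<eta>\<in>underS \<kappa> \<delta>. \<xi> \<in> underS \<kappa> \<eta>)"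


section \<open>Inductive sequences\<close>

record ('k, 'o, 'a) seq =
  idx :: "'k set"
  ob :: "'k \<Rightarrow> 'o"
  bond :: "'k \<times> 'k \<Rightarrow> 'a"

text \<open>
  Inductive sequences of length \<open>\<le> \<kappa>\<close>, the length being \<open>idx x\<close>.  The two \<open>extensional\<close> clauses make
  the HOL record determined by the functor it represents, so that equality of records is
  equality of sequences.
\<close>

definition inductive_seq :: "('o, 'a) cat \<Rightarrow> 'k rel \<Rightarrow> ('k, 'o, 'a) seq \<Rightarrow> bool" where
  "inductive_seq C \<kappa> x \<longleftrightarrow>
     ofilter \<kappa> (idx x) \<and> idx x \<noteq> {} \<and>
     ob x \<in> idx x \<rightarrow> Obj C \<and>
     (\<forall>\<xi>\<in>idx x. \<forall>\<eta>\<in>idx x. (\<xi>, \<eta>) \<in> \<kappa> \<longrightarrow> bond x (\<xi>, \<eta>) \<in> homset C (ob x \<xi>) (ob x \<eta>)) \<and>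
     (\<forall>\<xi>\<in>idx x. bond x (\<xi>, \<xi>) = Ident C (ob x \<xi>)) \<and>
     (\<forall>\<xi>\<in>idx x. \<forall>\<eta>\<in>idx x. \<forall>\<zeta>\<in>idx x. (\<xi>, \<eta>) \<in> \<kappa> \<longrightarrow> (\<eta>, \<zeta>) \<in> \<kappa> \<longrightarrow>
        bond x (\<eta>, \<zeta>) \<bullet>\<^bsub>C\<^esub> bond x (\<xi>, \<eta>) = bond x (\<xi>, \<zeta>)) \<and>
     ob x \<in> extensional (idx x) \<and> bond x \<in> extensional (Restr \<kappa> (idx x))"

text \<open>The objects of \<open>Seq\<^sub><\<^sub>\<kappa>\<close>.\<close>

definition small_seqs :: "('o, 'a) cat \<Rightarrow> 'k rel \<Rightarrow> ('k, 'o, 'a) seq set" where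
  "small_seqs C \<kappa> = {x. inductive_seq C \<kappa> x \<and> (\<exists>\<delta>\<in>Field \<kappa>. idx x = underS \<kappa> \<delta>)}"

definition restrict_seq :: "'k rel \<Rightarrow> ('k, 'o, 'a) seq \<Rightarrow> 'k \<Rightarrow> ('k, 'o, 'a) seq" where
  "restrict_seq \<kappa> x \<delta> =
     \<lparr>idx = underS \<kappa> \<delta>,
      ob = restrict (ob x) (underS \<kappa> \<delta>),
      bond = restrict (bond x) (Restr \<kappa> (underS \<kappa> \<delta>))\<rparr>"

text \<open>An object of the category as a sequence of length \<open>1\<close>.\<close>

definition obj_seq :: "('o, 'a) cat \<Rightarrow> 'k rel \<Rightarrow> 'o \<Rightarrow> ('k, 'o, 'a) seq" where
  "obj_seq C \<kappa> a =
     \<lparr>idx = {ord_zero \<kappa>},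
      ob = (\<lambda>_\<in>{ord_zero \<kappa>}. a),
      bond = (\<lambda>_\<in>Restr \<kappa> {ord_zero \<kappa>}. Ident C a)\<rparr>"


section \<open>Arrows of sequences\<close>

type_synonym ('k, 'a) trans = "('k \<Rightarrow> 'k) \<times> ('k \<Rightarrow> 'a)"

definition transformations ::
  "('o, 'a) cat \<Rightarrow> 'k rel \<Rightarrow> ('k, 'o, 'a) seq \<Rightarrow> ('k, 'o, 'a) seq \<Rightarrow> ('k, 'a) trans set" where
  "transformations C \<kappa> x y =
     {(\<phi>, F).
        \<phi> \<in> idx x \<rightarrow>\<^sub>E idx y \<and>
        (\<forall>\<alpha>\<in>idx x. \<forall>\<beta>\<in>idx x. (\<alpha>, \<beta>) \<in> \<kappa> \<longrightarrow> (\<phi> \<alpha>, \<phi> \<beta>) \<in> \<kappa>) \<and>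
        F \<in> extensional (idx x) \<and>
        (\<forall>\<alpha>\<in>idx x. F \<alpha> \<in> homset C (ob x \<alpha>) (ob y (\<phi> \<alpha>))) \<and>
        (\<forall>\<alpha>\<in>idx x. \<forall>\<beta>\<in>idx x. (\<alpha>, \<beta>) \<in> \<kappa> \<longrightarrow>
           F \<beta> \<bullet>\<^bsub>C\<^esub> bond x (\<alpha>, \<beta>) = bond y (\<phi> \<alpha>, \<phi> \<beta>) \<bullet>\<^bsub>C\<^esub> F \<alpha>)}"

definition trans_equiv ::
  "('o, 'a) cat \<Rightarrow> 'k rel \<Rightarrow> ('k, 'o, 'a) seq \<Rightarrow> ('k, 'o, 'a) seq \<Rightarrow> ('k, 'a) trans rel" where
  "trans_equiv C \<kappa> x y =
     {((\<phi>, F), (\<psi>, G)).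
        (\<phi>, F) \<in> transformations C \<kappa> x y \<and> (\<psi>, G) \<in> transformations C \<kappa> x y \<and>
        (\<forall>\<alpha>\<in>idx x. \<exists>\<gamma>\<in>idx y. (\<phi> \<alpha>, \<gamma>) \<in> \<kappa> \<and> (\<psi> \<alpha>, \<gamma>) \<in> \<kappa> \<and>
           bond y (\<phi> \<alpha>, \<gamma>) \<bullet>\<^bsub>C\<^esub> F \<alpha> = bond y (\<psi> \<alpha>, \<gamma>) \<bullet>\<^bsub>C\<^esub> G \<alpha>)}"

definition seq_homset ::
  "('o, 'a) cat \<Rightarrow> 'k rel \<Rightarrow> ('k, 'o, 'a) seq \<Rightarrow> ('k, 'o, 'a) seq \<Rightarrow> ('k, 'a) trans set set" where
  "seq_homset C \<kappa> x y = transformations C \<kappa> x y // trans_equiv C \<kappa> x y"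

definition trans_class ::
  "('o, 'a) cat \<Rightarrow> 'k rel \<Rightarrow> ('k, 'o, 'a) seq \<Rightarrow> ('k, 'o, 'a) seq \<Rightarrow>
     ('k, 'a) trans \<Rightarrow> ('k, 'a) trans set" where
  "trans_class C \<kappa> x y t = trans_equiv C \<kappa> x y `` {t}"

definition trans_comp ::
  "('o, 'a) cat \<Rightarrow> ('k, 'o, 'a) seq \<Rightarrow> ('k, 'a) trans \<Rightarrow> ('k, 'a) trans \<Rightarrow> ('k, 'a) trans" where
  "trans_comp C x s t =
     (\<lambda>\<alpha>\<in>idx x. fst s (fst t \<alpha>), \<lambda>\<alpha>\<in>idx x. snd s (fst t \<alpha>) \<bullet>\<^bsub>C\<^esub> snd t \<alpha>)"

text \<open>
  The composite of \<open>f : x \<rightarrow> y\<close> followed by \<open>g : y \<rightarrow> z\<close>, written \<open>seq_comp C \<kappa> x z g f\<close>: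
  all composites of representatives lie in one class (see \<open>seq_comp_class\<close> below), so the
  union is that class.
\<close>

definition seq_comp ::
  "('o, 'a) cat \<Rightarrow> 'k rel \<Rightarrow> ('k, 'o, 'a) seq \<Rightarrow> ('k, 'o, 'a) seq \<Rightarrow>
     ('k, 'a) trans set \<Rightarrow> ('k, 'a) trans set \<Rightarrow> ('k, 'a) trans set" where
  "seq_comp C \<kappa> x z g f = (\<Union>s\<in>g. \<Union>t\<in>f. trans_class C \<kappa> x z (trans_comp C x s t))"

lemma Comp_homset:
  assumes "category C" "f \<in> homset C a b" "g \<in> homset C b c"
  shows "g \<bullet>\<^bsub>C\<^esub> f \<in> homset C a c"
  using assms by (auto simp: category_def homset_def)

lemma Comp_assoc:
  assumes "category C" "f \<in> homset C a b" "g \<in> homset C b c" "h \<in> homset C c d"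
  shows "h \<bullet>\<^bsub>C\<^esub> (g \<bullet>\<^bsub>C\<^esub> f) = (h \<bullet>\<^bsub>C\<^esub> g) \<bullet>\<^bsub>C\<^esub> f"
  using assms by (auto simp: category_def homset_def)

lemma bond_homset:
  assumes "inductive_seq C \<kappa> x" "\<xi> \<in> idx x" "\<eta> \<in> idx x" "(\<xi>, \<eta>) \<in> \<kappa>"
  shows "bond x (\<xi>, \<eta>) \<in> homset C (ob x \<xi>) (ob x \<eta>)"
  using assms by (auto simp: inductive_seq_def)

lemma bond_bond:
  assumes "inductive_seq C \<kappa> x" "\<xi> \<in> idx x" "\<eta> \<in> idx x" "\<zeta> \<in> idx x"
    "(\<xi>, \<eta>) \<in> \<kappa>" "(\<eta>, \<zeta>) \<in> \<kappa>"
  shows "bond x (\<eta>, \<zeta>) \<bullet>\<^bsub>C\<^esub> bond x (\<xi>, \<eta>) = bond x (\<xi>, \<zeta>)"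
  using assms by (auto simp: inductive_seq_def)

lemma bond_push:
  assumes "category C" "inductive_seq C \<kappa> y" "\<xi> \<in> idx y" "\<eta> \<in> idx y" "\<zeta> \<in> idx y"
    "(\<xi>, \<eta>) \<in> \<kappa>" "(\<eta>, \<zeta>) \<in> \<kappa>" "f \<in> homset C a (ob y \<xi>)"
  shows "bond y (\<xi>, \<zeta>) \<bullet>\<^bsub>C\<^esub> f = bond y (\<eta>, \<zeta>) \<bullet>\<^bsub>C\<^esub> (bond y (\<xi>, \<eta>) \<bullet>\<^bsub>C\<^esub> f)"
proof -
  have "bond y (\<eta>, \<zeta>) \<bullet>\<^bsub>C\<^esub> (bond y (\<xi>, \<eta>) \<bullet>\<^bsub>C\<^esub> f) =
      (bond y (\<eta>, \<zeta>) \<bullet>\<^bsub>C\<^esub> bond y (\<xi>, \<eta>)) \<bullet>\<^bsub>C\<^esub> f"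
    by (rule Comp_assoc[OF assms(1) assms(8) bond_homset[OF assms(2,3,4,6)]
          bond_homset[OF assms(2,4,5,7)]])
  then show ?thesis
    using bond_bond[OF assms(2-7)] by simp
qed

lemma equiv_trans_equiv:
  assumes "Well_order \<kappa>" "category C" "inductive_seq C \<kappa> x" "inductive_seq C \<kappa> y"
  shows "equiv (transformations C \<kappa> x y) (trans_equiv C \<kappa> x y)"
proof -
  interpret wo_rel \<kappa> using assms(1) by (simp add: wo_rel_def)
  have refl\<kappa>: "(\<xi>, \<xi>) \<in> \<kappa>" if "\<xi> \<in> idx y" for \<xi>
    using assms(4) that REFL by (auto simp: inductive_seq_def Order_Relation.ofilter_def refl_on_def)
  have sub: "idx y \<subseteq> Field \<kappa>"
    using assms(4) by (auto simp: inductive_seq_def Order_Relation.ofilter_def)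
  have "trans (trans_equiv C \<kappa> x y)"
  proof (rule transI)
    fix s t r assume st: "(s, t) \<in> trans_equiv C \<kappa> x y" and tr: "(t, r) \<in> trans_equiv C \<kappa> x y"
    obtain \<phi> F where s: "s = (\<phi>, F)" by (cases s)
    obtain \<psi> G where t: "t = (\<psi>, G)" by (cases t)
    obtain \<chi> H where r: "r = (\<chi>, H)" by (cases r)
    have T: "s \<in> transformations C \<kappa> x y" "t \<in> transformations C \<kappa> x y"
      "r \<in> transformations C \<kappa> x y"
      using st tr by (auto simp: trans_equiv_def)
    have "\<exists>\<gamma>\<in>idx y. (\<phi> \<alpha>, \<gamma>) \<in> \<kappa> \<and> (\<chi> \<alpha>, \<gamma>) \<in> \<kappa> \<and>
           bond y (\<phi> \<alpha>, \<gamma>) \<bullet>\<^bsub>C\<^esub> F \<alpha> = bond y (\<chi> \<alpha>, \<gamma>) \<bullet>\<^bsub>C\<^esub> H \<alpha>" if a: "\<alpha> \<in> idx x" for \<alpha>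
    proof -
      obtain \<gamma> where g: "\<gamma> \<in> idx y" "(\<phi> \<alpha>, \<gamma>) \<in> \<kappa>" "(\<psi> \<alpha>, \<gamma>) \<in> \<kappa>"
        "bond y (\<phi> \<alpha>, \<gamma>) \<bullet>\<^bsub>C\<^esub> F \<alpha> = bond y (\<psi> \<alpha>, \<gamma>) \<bullet>\<^bsub>C\<^esub> G \<alpha>"
        using st a by (auto simp: trans_equiv_def s t)
      obtain \<delta> where d: "\<delta> \<in> idx y" "(\<psi> \<alpha>, \<delta>) \<in> \<kappa>" "(\<chi> \<alpha>, \<delta>) \<in> \<kappa>"
        "bond y (\<psi> \<alpha>, \<delta>) \<bullet>\<^bsub>C\<^esub> G \<alpha> = bond y (\<chi> \<alpha>, \<delta>) \<bullet>\<^bsub>C\<^esub> H \<alpha>"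
        using tr a by (auto simp: trans_equiv_def t r)
      obtain \<epsilon> where e: "\<epsilon> \<in> idx y" "(\<gamma>, \<epsilon>) \<in> \<kappa>" "(\<delta>, \<epsilon>) \<in> \<kappa>"
        by (metis TOTALS d(1) g(1) refl\<kappa> sub subsetD)
      have h: "\<phi> \<alpha> \<in> idx y" "\<psi> \<alpha> \<in> idx y" "\<chi> \<alpha> \<in> idx y"
        "F \<alpha> \<in> homset C (ob x \<alpha>) (ob y (\<phi> \<alpha>))" "G \<alpha> \<in> homset C (ob x \<alpha>) (ob y (\<psi> \<alpha>))"
        "H \<alpha> \<in> homset C (ob x \<alpha>) (ob y (\<chi> \<alpha>))"
        using T a by (auto simp: transformations_def s t r)
      note push = bond_push[OF assms(2,4)]
      have "bond y (\<phi> \<alpha>, \<epsilon>) \<bullet>\<^bsub>C\<^esub> F \<alpha> = bond y (\<gamma>, \<epsilon>) \<bullet>\<^bsub>C\<^esub> (bond y (\<phi> \<alpha>, \<gamma>) \<bullet>\<^bsub>C\<^esub> F \<alpha>)"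
        by (rule push) (use g e h in auto)
      also have "\<dots> = bond y (\<psi> \<alpha>, \<epsilon>) \<bullet>\<^bsub>C\<^esub> G \<alpha>"
        unfolding g(4) by (rule push[symmetric]) (use g e h in auto)
      also have "\<dots> = bond y (\<delta>, \<epsilon>) \<bullet>\<^bsub>C\<^esub> (bond y (\<psi> \<alpha>, \<delta>) \<bullet>\<^bsub>C\<^esub> G \<alpha>)"
        by (rule push) (use d e h in auto)
      also have "\<dots> = bond y (\<chi> \<alpha>, \<epsilon>) \<bullet>\<^bsub>C\<^esub> H \<alpha>"
        unfolding d(4) by (rule push[symmetric]) (use d e h in auto)
      finally show ?thesis
        using e g(2) d(3) TRANS by (meson transD)
    qed
    then show "(s, r) \<in> trans_equiv C \<kappa> x y"
      using T by (auto simp: trans_equiv_def s r)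
  qed
  moreover have "sym (trans_equiv C \<kappa> x y)"
    unfolding sym_def trans_equiv_def by (clarsimp, metis)
  moreover have "refl_on (transformations C \<kappa> x y) (trans_equiv C \<kappa> x y)"
    using refl\<kappa> by (auto simp: refl_on_def trans_equiv_def transformations_def PiE_iff)
  moreover have "trans_equiv C \<kappa> x y \<subseteq> transformations C \<kappa> x y \<times> transformations C \<kappa> x y"
    by (auto simp: trans_equiv_def)
  ultimately show ?thesis by (auto intro: equivI)
qed

lemma trans_comp_closed:
  assumes "category C" "inductive_seq C \<kappa> x" "inductive_seq C \<kappa> y" "inductive_seq C \<kappa> z"
    and t: "t \<in> transformations C \<kappa> x y" and s: "s \<in> transformations C \<kappa> y z"
  shows "trans_comp C x s t \<in> transformations C \<kappa> x z"
proof -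
  obtain \<phi> F where tt: "t = (\<phi>, F)" by (cases t)
  obtain \<psi> G where ss: "s = (\<psi>, G)" by (cases s)
  have F: "\<phi> \<alpha> \<in> idx y" "F \<alpha> \<in> homset C (ob x \<alpha>) (ob y (\<phi> \<alpha>))" if "\<alpha> \<in> idx x" for \<alpha>
    using t that by (auto simp: tt transformations_def)
  have G: "\<psi> \<alpha> \<in> idx z" "G \<alpha> \<in> homset C (ob y \<alpha>) (ob z (\<psi> \<alpha>))" if "\<alpha> \<in> idx y" for \<alpha>
    using s that by (auto simp: ss transformations_def)
  have mF: "(\<phi> \<alpha>, \<phi> \<beta>) \<in> \<kappa>" "F \<beta> \<bullet>\<^bsub>C\<^esub> bond x (\<alpha>, \<beta>) = bond y (\<phi> \<alpha>, \<phi> \<beta>) \<bullet>\<^bsub>C\<^esub> F \<alpha>"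
    if "\<alpha> \<in> idx x" "\<beta> \<in> idx x" "(\<alpha>, \<beta>) \<in> \<kappa>" for \<alpha> \<beta>
    using t that by (auto simp: tt transformations_def)
  have mG: "(\<psi> \<alpha>, \<psi> \<beta>) \<in> \<kappa>" "G \<beta> \<bullet>\<^bsub>C\<^esub> bond y (\<alpha>, \<beta>) = bond z (\<psi> \<alpha>, \<psi> \<beta>) \<bullet>\<^bsub>C\<^esub> G \<alpha>"
    if "\<alpha> \<in> idx y" "\<beta> \<in> idx y" "(\<alpha>, \<beta>) \<in> \<kappa>" for \<alpha> \<beta>
    using s that by (auto simp: ss transformations_def)
  have nat: "(G (\<phi> \<beta>) \<bullet>\<^bsub>C\<^esub> F \<beta>) \<bullet>\<^bsub>C\<^esub> bond x (\<alpha>, \<beta>) =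
      bond z (\<psi> (\<phi> \<alpha>), \<psi> (\<phi> \<beta>)) \<bullet>\<^bsub>C\<^esub> (G (\<phi> \<alpha>) \<bullet>\<^bsub>C\<^esub> F \<alpha>)"
    if ab: "\<alpha> \<in> idx x" "\<beta> \<in> idx x" "(\<alpha>, \<beta>) \<in> \<kappa>" for \<alpha> \<beta>
  proof -
    note m = mF[OF ab] and n = mG[OF F(1)[OF ab(1)] F(1)[OF ab(2)] mF(1)[OF ab]]
    note assoc = Comp_assoc[OF assms(1)]
    have "(G (\<phi> \<beta>) \<bullet>\<^bsub>C\<^esub> F \<beta>) \<bullet>\<^bsub>C\<^esub> bond x (\<alpha>, \<beta>) = G (\<phi> \<beta>) \<bullet>\<^bsub>C\<^esub> (F \<beta> \<bullet>\<^bsub>C\<^esub> bond x (\<alpha>, \<beta>))"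
      by (rule assoc[symmetric, OF bond_homset[OF assms(2) ab] F(2)[OF ab(2)] G(2)[OF F(1)[OF ab(2)]]])
    also have "\<dots> = (G (\<phi> \<beta>) \<bullet>\<^bsub>C\<^esub> bond y (\<phi> \<alpha>, \<phi> \<beta>)) \<bullet>\<^bsub>C\<^esub> F \<alpha>"
      unfolding m(2)
      by (rule assoc[OF F(2)[OF ab(1)] bond_homset[OF assms(3) F(1)[OF ab(1)] F(1)[OF ab(2)] m(1)]
            G(2)[OF F(1)[OF ab(2)]]])
    also have "\<dots> = bond z (\<psi> (\<phi> \<alpha>), \<psi> (\<phi> \<beta>)) \<bullet>\<^bsub>C\<^esub> (G (\<phi> \<alpha>) \<bullet>\<^bsub>C\<^esub> F \<alpha>)"
      unfolding n(2)
      by (rule assoc[symmetric, OF F(2)[OF ab(1)] G(2)[OF F(1)[OF ab(1)]]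
            bond_homset[OF assms(4) G(1)[OF F(1)[OF ab(1)]] G(1)[OF F(1)[OF ab(2)]] n(1)]])
    finally show ?thesis .
  qed
  have GF: "G (\<phi> \<alpha>) \<bullet>\<^bsub>C\<^esub> F \<alpha> \<in> homset C (ob x \<alpha>) (ob z (\<psi> (\<phi> \<alpha>)))" if "\<alpha> \<in> idx x" for \<alpha>
    by (rule Comp_homset[OF assms(1) F(2)[OF that] G(2)[OF F(1)[OF that]]])
  show ?thesis
    unfolding trans_comp_def transformations_def tt ss
    by (simp add: F(1) G(1) mF(1) mG(1) GF nat)
qed

lemma trans_comp_cong:
  assumes "Well_order \<kappa>" "category C"
    "inductive_seq C \<kappa> x" "inductive_seq C \<kappa> y" "inductive_seq C \<kappa> z"
    and t: "(t, t') \<in> trans_equiv C \<kappa> x y" and s: "(s, s') \<in> trans_equiv C \<kappa> y z"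
  shows "(trans_comp C x s t, trans_comp C x s' t') \<in> trans_equiv C \<kappa> x z"
proof -
  obtain \<phi> F where tt: "t = (\<phi>, F)" by (cases t)
  obtain \<phi>' F' where tt': "t' = (\<phi>', F')" by (cases t')
  obtain \<psi> G where ss: "s = (\<psi>, G)" by (cases s)
  obtain \<psi>' G' where ss': "s' = (\<psi>', G')" by (cases s')
  have T: "t \<in> transformations C \<kappa> x y" "t' \<in> transformations C \<kappa> x y"
    "s \<in> transformations C \<kappa> y z" "s' \<in> transformations C \<kappa> y z"
    using t s by (auto simp: trans_equiv_def)
  note equiv_xz = equiv_trans_equiv[OF assms(1,2,3,5)]
  have left: "(trans_comp C x s t, trans_comp C x s t') \<in> trans_equiv C \<kappa> x z"
  proof -
    have "\<exists>\<gamma>\<in>idx z. (\<psi> (\<phi> \<alpha>), \<gamma>) \<in> \<kappa> \<and> (\<psi> (\<phi>' \<alpha>), \<gamma>) \<in> \<kappa> \<and>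
        bond z (\<psi> (\<phi> \<alpha>), \<gamma>) \<bullet>\<^bsub>C\<^esub> (G (\<phi> \<alpha>) \<bullet>\<^bsub>C\<^esub> F \<alpha>) =
        bond z (\<psi> (\<phi>' \<alpha>), \<gamma>) \<bullet>\<^bsub>C\<^esub> (G (\<phi>' \<alpha>) \<bullet>\<^bsub>C\<^esub> F' \<alpha>)" if a: "\<alpha> \<in> idx x" for \<alpha>
    proof -
      obtain \<gamma> where g: "\<gamma> \<in> idx y" "(\<phi> \<alpha>, \<gamma>) \<in> \<kappa>" "(\<phi>' \<alpha>, \<gamma>) \<in> \<kappa>"
        "bond y (\<phi> \<alpha>, \<gamma>) \<bullet>\<^bsub>C\<^esub> F \<alpha> = bond y (\<phi>' \<alpha>, \<gamma>) \<bullet>\<^bsub>C\<^esub> F' \<alpha>"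
        using t a by (auto simp: trans_equiv_def tt tt')
      have move: "bond z (\<psi> \<theta>, \<psi> \<gamma>) \<bullet>\<^bsub>C\<^esub> (G \<theta> \<bullet>\<^bsub>C\<^esub> f) = G \<gamma> \<bullet>\<^bsub>C\<^esub> (bond y (\<theta>, \<gamma>) \<bullet>\<^bsub>C\<^esub> f)"
        if th: "\<theta> \<in> idx y" "(\<theta>, \<gamma>) \<in> \<kappa>" and f: "f \<in> homset C (ob x \<alpha>) (ob y \<theta>)" for \<theta> f
      proof -
        have S: "\<psi> \<theta> \<in> idx z" "\<psi> \<gamma> \<in> idx z" "(\<psi> \<theta>, \<psi> \<gamma>) \<in> \<kappa>"
          "G \<theta> \<in> homset C (ob y \<theta>) (ob z (\<psi> \<theta>))" "G \<gamma> \<in> homset C (ob y \<gamma>) (ob z (\<psi> \<gamma>))"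
          "G \<gamma> \<bullet>\<^bsub>C\<^esub> bond y (\<theta>, \<gamma>) = bond z (\<psi> \<theta>, \<psi> \<gamma>) \<bullet>\<^bsub>C\<^esub> G \<theta>"
          using T(3) th g(1) by (auto simp: ss transformations_def)
        show ?thesis
          using Comp_assoc[OF assms(2) f S(4) bond_homset[OF assms(5) S(1-3)]]
            Comp_assoc[OF assms(2) f bond_homset[OF assms(4) th(1) g(1) th(2)] S(5)] S(6)
          by simp
      qed
      have P: "\<phi> \<alpha> \<in> idx y" "F \<alpha> \<in> homset C (ob x \<alpha>) (ob y (\<phi> \<alpha>))"
        "\<phi>' \<alpha> \<in> idx y" "F' \<alpha> \<in> homset C (ob x \<alpha>) (ob y (\<phi>' \<alpha>))"
        using T a by (auto simp: tt tt' transformations_def)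
      have Q: "\<psi> \<gamma> \<in> idx z" "(\<psi> (\<phi> \<alpha>), \<psi> \<gamma>) \<in> \<kappa>" "(\<psi> (\<phi>' \<alpha>), \<psi> \<gamma>) \<in> \<kappa>"
        using T(3) P g by (auto simp: ss transformations_def)
      show ?thesis
        using Q move[OF P(1) g(2) P(2)] move[OF P(3) g(3) P(4)] g(4) by auto
    qed
    then show ?thesis
      using trans_comp_closed[OF assms(2-5) T(1) T(3)] trans_comp_closed[OF assms(2-5) T(2) T(3)]
      unfolding trans_equiv_def trans_comp_def ss tt tt' by auto
  qed
  have right: "(trans_comp C x s t', trans_comp C x s' t') \<in> trans_equiv C \<kappa> x z"
  proof -
    have "\<exists>\<gamma>\<in>idx z. (\<psi> (\<phi>' \<alpha>), \<gamma>) \<in> \<kappa> \<and> (\<psi>' (\<phi>' \<alpha>), \<gamma>) \<in> \<kappa> \<and>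
        bond z (\<psi> (\<phi>' \<alpha>), \<gamma>) \<bullet>\<^bsub>C\<^esub> (G (\<phi>' \<alpha>) \<bullet>\<^bsub>C\<^esub> F' \<alpha>) =
        bond z (\<psi>' (\<phi>' \<alpha>), \<gamma>) \<bullet>\<^bsub>C\<^esub> (G' (\<phi>' \<alpha>) \<bullet>\<^bsub>C\<^esub> F' \<alpha>)" if a: "\<alpha> \<in> idx x" for \<alpha>
    proof -
      have P: "\<phi>' \<alpha> \<in> idx y" "F' \<alpha> \<in> homset C (ob x \<alpha>) (ob y (\<phi>' \<alpha>))"
        using T a by (auto simp: tt' transformations_def)
      obtain \<gamma> where g: "\<gamma> \<in> idx z" "(\<psi> (\<phi>' \<alpha>), \<gamma>) \<in> \<kappa>" "(\<psi>' (\<phi>' \<alpha>), \<gamma>) \<in> \<kappa>"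
        "bond z (\<psi> (\<phi>' \<alpha>), \<gamma>) \<bullet>\<^bsub>C\<^esub> G (\<phi>' \<alpha>) = bond z (\<psi>' (\<phi>' \<alpha>), \<gamma>) \<bullet>\<^bsub>C\<^esub> G' (\<phi>' \<alpha>)"
        using s P(1) by (auto simp: trans_equiv_def ss ss')
      have S: "\<psi> (\<phi>' \<alpha>) \<in> idx z" "G (\<phi>' \<alpha>) \<in> homset C (ob y (\<phi>' \<alpha>)) (ob z (\<psi> (\<phi>' \<alpha>)))"
        "\<psi>' (\<phi>' \<alpha>) \<in> idx z" "G' (\<phi>' \<alpha>) \<in> homset C (ob y (\<phi>' \<alpha>)) (ob z (\<psi>' (\<phi>' \<alpha>)))"
        using T P(1) by (auto simp: ss ss' transformations_def)
      show ?thesis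
        using Comp_assoc[OF assms(2) P(2) S(2) bond_homset[OF assms(5) S(1) g(1,2)]]
          Comp_assoc[OF assms(2) P(2) S(4) bond_homset[OF assms(5) S(3) g(1) g(3)]] g
        by auto
    qed
    then show ?thesis
      using trans_comp_closed[OF assms(2-5) T(2) T(3)] trans_comp_closed[OF assms(2-5) T(2) T(4)]
      unfolding trans_equiv_def trans_comp_def ss ss' tt' by auto
  qed
  show ?thesis
    using left right equiv_xz by (meson equiv_def transD)
qed

lemma seq_comp_class:
  assumes "Well_order \<kappa>" "category C"
    "inductive_seq C \<kappa> x" "inductive_seq C \<kappa> y" "inductive_seq C \<kappa> z"
    and t: "t \<in> transformations C \<kappa> x y" and s: "s \<in> transformations C \<kappa> y z"
  shows "seq_comp C \<kappa> x z (trans_class C \<kappa> y z s) (trans_class C \<kappa> x y t) =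
         trans_class C \<kappa> x z (trans_comp C x s t)"
proof -
  have e: "trans_class C \<kappa> x z (trans_comp C x s' t') = trans_class C \<kappa> x z (trans_comp C x s t)"
    if "s' \<in> trans_class C \<kappa> y z s" "t' \<in> trans_class C \<kappa> x y t" for s' t'
    using that trans_comp_cong[OF assms(1-5), of t t' s s']
      equiv_class_eq[OF equiv_trans_equiv[OF assms(1-3) assms(5)]]
    unfolding trans_class_def by fastforce
  have "s \<in> trans_class C \<kappa> y z s" "t \<in> trans_class C \<kappa> x y t"
    using equiv_class_self[OF equiv_trans_equiv[OF assms(1,2,4,5)] s]
      equiv_class_self[OF equiv_trans_equiv[OF assms(1,2,3,4)] t]
    by (auto simp: trans_class_def)
  with e show ?thesis unfolding seq_comp_def by blast
qed

definition seq_ident ::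
  "('o, 'a) cat \<Rightarrow> 'k rel \<Rightarrow> ('k, 'o, 'a) seq \<Rightarrow> ('k, 'a) trans set" where
  "seq_ident C \<kappa> x = trans_class C \<kappa> x x (\<lambda>\<alpha>\<in>idx x. \<alpha>, \<lambda>\<alpha>\<in>idx x. Ident C (ob x \<alpha>))"

definition seq_isos ::
  "('o, 'a) cat \<Rightarrow> 'k rel \<Rightarrow> ('k, 'o, 'a) seq \<Rightarrow> ('k, 'o, 'a) seq \<Rightarrow> ('k, 'a) trans set set" where
  "seq_isos C \<kappa> x y =
     {h \<in> seq_homset C \<kappa> x y. \<exists>g\<in>seq_homset C \<kappa> y x.
        seq_comp C \<kappa> x x g h = seq_ident C \<kappa> x \<and> seq_comp C \<kappa> y y h g = seq_ident C \<kappa> y}"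

text \<open>The arrow \<open>u\<^sub>\<alpha>\<^sup>\<infinity> : u\<^sub>\<alpha> \<rightarrow> u\<close> represented by the identity of \<open>u\<^sub>\<alpha>\<close>.\<close>

definition seq_inj ::
  "('o, 'a) cat \<Rightarrow> 'k rel \<Rightarrow> ('k, 'o, 'a) seq \<Rightarrow> 'k \<Rightarrow> ('k, 'a) trans set" where
  "seq_inj C \<kappa> u \<alpha> =
     trans_class C \<kappa> (obj_seq C \<kappa> (ob u \<alpha>)) u
       (\<lambda>_\<in>{ord_zero \<kappa>}. \<alpha>, \<lambda>_\<in>{ord_zero \<kappa>}. Ident C (ob u \<alpha>))"


section \<open>Partial quasi-limiting operators, continuity, Fraisse sequences\<close>

text \<open>
  \<open>qapex L x\<close> and \<open>qleg L x \<xi>\<close> are the apex and the arrows of the co-cone assigned to \<open>x\<close>;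
  \<open>qmor L x y h\<close> is the arrow assigned to the isomorphism \<open>h : x \<rightarrow> y\<close> of sequences.
\<close>

record ('k, 'o, 'a) qlim =
  qdom :: "('k, 'o, 'a) seq set"
  qapex :: "('k, 'o, 'a) seq \<Rightarrow> 'o"
  qleg :: "('k, 'o, 'a) seq \<Rightarrow> 'k \<Rightarrow> 'a"
  qmor :: "('k, 'o, 'a) seq \<Rightarrow> ('k, 'o, 'a) seq \<Rightarrow> ('k, 'a) trans set \<Rightarrow> 'a"

definition cocone ::
  "('o, 'a) cat \<Rightarrow> 'k rel \<Rightarrow> ('k, 'o, 'a) seq \<Rightarrow> 'o \<Rightarrow> ('k \<Rightarrow> 'a) \<Rightarrow> bool" where
  "cocone C \<kappa> x a c \<longleftrightarrow>
     a \<in> Obj C \<and> (\<forall>\<xi>\<in>idx x. c \<xi> \<in> homset C (ob x \<xi>) a) \<and>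
     (\<forall>\<xi>\<in>idx x. \<forall>\<eta>\<in>idx x. \<xi> \<in> underS \<kappa> \<eta> \<longrightarrow> c \<eta> \<bullet>\<^bsub>C\<^esub> bond x (\<xi>, \<eta>) = c \<xi>)"

definition partial_quasi_limiting ::
  "('o, 'a) cat \<Rightarrow> 'k rel \<Rightarrow> ('k, 'o, 'a) qlim \<Rightarrow> bool" where
  "partial_quasi_limiting C \<kappa> L \<longleftrightarrow>
     qdom L \<subseteq> small_seqs C \<kappa> \<and>
     (\<forall>x\<in>qdom L. \<forall>y\<in>small_seqs C \<kappa>. seq_isos C \<kappa> x y \<noteq> {} \<longrightarrow> y \<in> qdom L) \<and>
     (\<forall>x\<in>qdom L. cocone C \<kappa> x (qapex L x) (qleg L x)) \<and>
     (\<forall>x\<in>qdom L. \<forall>y\<in>qdom L. \<forall>h\<in>seq_isos C \<kappa> x y.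
        qmor L x y h \<in> isos C (qapex L x) (qapex L y) \<and>
        (\<forall>(\<phi>, F)\<in>h. \<forall>\<xi>\<in>idx x. qmor L x y h \<bullet>\<^bsub>C\<^esub> qleg L x \<xi> = qleg L y (\<phi> \<xi>) \<bullet>\<^bsub>C\<^esub> F \<xi>)) \<and>
     (\<forall>x\<in>qdom L. qmor L x x (seq_ident C \<kappa> x) = Ident C (qapex L x)) \<and>
     (\<forall>x\<in>qdom L. \<forall>y\<in>qdom L. \<forall>z\<in>qdom L. \<forall>h\<in>seq_isos C \<kappa> x y. \<forall>k\<in>seq_isos C \<kappa> y z.
        qmor L x z (seq_comp C \<kappa> x z k h) = qmor L y z k \<bullet>\<^bsub>C\<^esub> qmor L x y h)"

definition qlim_continuous ::
  "'k rel \<Rightarrow> ('k, 'o, 'a) qlim \<Rightarrow> ('k, 'o, 'a) seq \<Rightarrow> bool" where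
  "qlim_continuous \<kappa> L x \<longleftrightarrow>
     (\<forall>\<delta>\<in>idx x. limit_ord \<kappa> \<delta> \<longrightarrow>
        restrict_seq \<kappa> x \<delta> \<in> qdom L \<and>
        ob x \<delta> = qapex L (restrict_seq \<kappa> x \<delta>) \<and>
        (\<forall>\<xi>\<in>underS \<kappa> \<delta>. bond x (\<xi>, \<delta>) = qleg L (restrict_seq \<kappa> x \<delta>) \<xi>))"

definition fraisse_seq :: "('o, 'a) cat \<Rightarrow> 'k rel \<Rightarrow> ('k, 'o, 'a) seq \<Rightarrow> bool" where
  "fraisse_seq C \<kappa> u \<longleftrightarrow>
     inductive_seq C \<kappa> u \<and> idx u = Field \<kappa> \<and>
     (\<forall>x\<in>Obj C. \<exists>\<xi>\<in>Field \<kappa>. homset C x (ob u \<xi>) \<noteq> {}) \<and>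
     (\<forall>\<xi>\<in>Field \<kappa>. \<forall>y\<in>Obj C. \<forall>f\<in>homset C (ob u \<xi>) y.
        \<exists>\<eta>\<in>Field \<kappa>. (\<xi>, \<eta>) \<in> \<kappa> \<and> (\<exists>g\<in>homset C y (ob u \<eta>). bond u (\<xi>, \<eta>) = g \<bullet>\<^bsub>C\<^esub> f))"

end

theory Submission
  imports Defs
begin

text \<open>
  The proof is a back-and-forth argument along \<open>\<kappa>\<close>, with the transfinite recursion replaced by a
  maximal chain.  A \<^emph>\<open>link\<close> is an arrow \<open>f : u\<^sub>\<alpha> \<rightarrow> v\<^sub>\<beta>\<close>, regarded as a stage of the desired
  isomorphism.  A link \<open>(\<alpha>', \<beta>', f')\<close> \<^emph>\<open>continues\<close> \<open>(\<alpha>, \<beta>, f)\<close> if \<open>\<alpha> < \<alpha>'\<close>, \<open>\<beta> < \<beta>'\<close> and there is an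
  arrow \<open>g : v\<^sub>\<beta> \<rightarrow> u\<^sub>\<alpha>\<^sub>'\<close> going back, so that \<open>g \<circ> f\<close> is the bonding arrow \<open>u\<^sub>\<alpha> \<rightarrow> u\<^sub>\<alpha>\<^sub>'\<close> and \<open>f' \<circ> g\<close> is
  the bonding arrow \<open>v\<^sub>\<beta> \<rightarrow> v\<^sub>\<beta>\<^sub>'\<close>.  This relation \<open>\<prec>\<close> is a strict partial order (\<open>prec_trans\<close>).

  A chain of links without largest element whose sources are cofinal in one sequence and whose targets
  are cofinal in another determines an isomorphism between the two sequences (\<open>cofinal_chain_iso\<close>).  This single fact is used
  twice.  It is used for the whole of \<open>u\<close> and \<open>v\<close>, to finish the proof, and for initial segments of
  them, to pass limit stages: a chain without largest element, bounded on both sides, has suprema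
  \<open>\<delta>\<close> of its sources and \<open>\<epsilon>\<close> of its targets, hence it determines an isomorphism
  \<open>u\<restriction>\<delta> \<rightarrow> v\<restriction>\<epsilon>\<close>; the quasi-limiting operator turns it into an arrow between the apexes, and
  these are \<open>u\<^sub>\<delta>\<close> and \<open>v\<^sub>\<epsilon>\<close> by continuity.  The resulting link continues the whole chain
  (\<open>link_limit\<close>).

  Let now \<open>T\<close> be a maximal chain among the links that are, or continue, the link that represents the
  given arrow.  Applying the amalgamation property (A) once in \<open>u\<close> and once in \<open>v\<close> continues any
  single link (\<open>link_extend\<close>), so \<open>T\<close> has no largest element; and by \<open>link_limit\<close> it is not bounded
  on both sides.  Sources and targets of \<open>T\<close> are equinumerous, and as \<open>\<kappa>\<close> is regular, boundedness is
  a matter of cardinality (\<open>bounded_iff_card_less\<close>); so \<open>T\<close> is unbounded on both sides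
  (\<open>cofinal_chain_above\<close>), and it determines the isomorphism sought.
\<close>

section \<open>Isomorphisms of sequences\<close>

locale sequence_pair =
  fixes C :: "('o, 'a) cat" and \<kappa> :: "'k rel" and x y :: "('k, 'o, 'a) seq"
  assumes well_order: "Well_order \<kappa>" and cat: "category C"
    and x_seq: "inductive_seq C \<kappa> x" and y_seq: "inductive_seq C \<kappa> y"
begin

lemma wo: "wo_rel \<kappa>"
  using well_order by (simp add: wo_rel_def)

lemmas comp_hom = Comp_homset[OF cat]
lemmas comp_assoc = Comp_assoc[OF cat]
lemmas x_bond = bond_homset[OF x_seq]
lemmas y_bond = bond_homset[OF y_seq]
lemmas x_push = bond_push[OF cat x_seq]
lemmas y_push = bond_push[OF cat y_seq]

lemma ord_trans: "(a, b) \<in> \<kappa> \<Longrightarrow> (b, c) \<in> \<kappa> \<Longrightarrow> (a, c) \<in> \<kappa>"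
  using wo_rel.TRANS[OF wo] by (rule transD)

lemma ord_antisym: "(a, b) \<in> \<kappa> \<Longrightarrow> (b, a) \<in> \<kappa> \<Longrightarrow> a = b"
  using wo_rel.ANTISYM[OF wo] by (rule antisymD)

lemma ord_total: "a \<in> Field \<kappa> \<Longrightarrow> b \<in> Field \<kappa> \<Longrightarrow> (a, b) \<in> \<kappa> \<or> (b, a) \<in> \<kappa>"
  using wo_rel.TOTALS[OF wo] by blast

lemma idx_Field: "idx x \<subseteq> Field \<kappa>" "idx y \<subseteq> Field \<kappa>"
  using x_seq y_seq by (auto simp: inductive_seq_def Order_Relation.ofilter_def)

lemma idx_refl: "\<xi> \<in> idx x \<Longrightarrow> (\<xi>, \<xi>) \<in> \<kappa>" "\<eta> \<in> idx y \<Longrightarrow> (\<eta>, \<eta>) \<in> \<kappa>"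
  using ord_total idx_Field by blast+

lemma x_total: "\<xi> \<in> idx x \<Longrightarrow> \<eta> \<in> idx x \<Longrightarrow> (\<xi>, \<eta>) \<in> \<kappa> \<or> (\<eta>, \<xi>) \<in> \<kappa>"
  using ord_total idx_Field by blast

lemma hom_ob: "f \<in> homset C a b \<Longrightarrow> a \<in> Obj C \<and> b \<in> Obj C"
  using cat by (auto simp: homset_def category_def)

lemma comp_id: "f \<in> homset C a b \<Longrightarrow> f \<bullet>\<^bsub>C\<^esub> Ident C a = f"
  using cat by (auto simp: homset_def category_def)

lemma id_comp: "f \<in> homset C a b \<Longrightarrow> Ident C b \<bullet>\<^bsub>C\<^esub> f = f"
  using cat by (auto simp: homset_def category_def)

lemma bond_refl: "\<xi> \<in> idx x \<Longrightarrow> bond x (\<xi>, \<xi>) = Ident C (ob x \<xi>)"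
  "\<eta> \<in> idx y \<Longrightarrow> bond y (\<eta>, \<eta>) = Ident C (ob y \<eta>)"
  using x_seq y_seq by (auto simp: inductive_seq_def)

lemma iso_classI:
  assumes st: "s \<in> transformations C \<kappa> y x" and tt: "t \<in> transformations C \<kappa> x y"
    and gf: "(trans_comp C x s t, (\<lambda>\<alpha>\<in>idx x. \<alpha>, \<lambda>\<alpha>\<in>idx x. Ident C (ob x \<alpha>))) \<in> trans_equiv C \<kappa> x x"
    and fg: "(trans_comp C y t s, (\<lambda>\<alpha>\<in>idx y. \<alpha>, \<lambda>\<alpha>\<in>idx y. Ident C (ob y \<alpha>))) \<in> trans_equiv C \<kappa> y y"
  shows "trans_class C \<kappa> x y t \<in> seq_isos C \<kappa> x y"
proof -
  have 1: "seq_comp C \<kappa> x x (trans_class C \<kappa> y x s) (trans_class C \<kappa> x y t) = seq_ident C \<kappa> x"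
    using seq_comp_class[OF well_order cat x_seq y_seq x_seq tt st]
      equiv_class_eq[OF equiv_trans_equiv[OF well_order cat x_seq x_seq] gf]
    by (simp add: seq_ident_def trans_class_def)
  have 2: "seq_comp C \<kappa> y y (trans_class C \<kappa> x y t) (trans_class C \<kappa> y x s) = seq_ident C \<kappa> y"
    using seq_comp_class[OF well_order cat y_seq x_seq y_seq st tt]
      equiv_class_eq[OF equiv_trans_equiv[OF well_order cat y_seq y_seq] fg]
    by (simp add: seq_ident_def trans_class_def)
  show ?thesis
    unfolding seq_isos_def seq_homset_def
    using 1 2 quotientI[OF tt] quotientI[OF st] by (auto simp: trans_class_def)
qed

lemma ident_transformation:
  "(\<lambda>\<alpha>\<in>idx x. \<alpha>, \<lambda>\<alpha>\<in>idx x. Ident C (ob x \<alpha>)) \<in> transformations C \<kappa> x x"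
  "(\<lambda>\<alpha>\<in>idx y. \<alpha>, \<lambda>\<alpha>\<in>idx y. Ident C (ob y \<alpha>)) \<in> transformations C \<kappa> y y"
proof -
  show "(\<lambda>\<alpha>\<in>idx x. \<alpha>, \<lambda>\<alpha>\<in>idx x. Ident C (ob x \<alpha>)) \<in> transformations C \<kappa> x x"
    unfolding transformations_def
    using x_bond[OF _ _ idx_refl(1)] bond_refl(1) comp_id[OF x_bond] id_comp[OF x_bond] by auto
  show "(\<lambda>\<alpha>\<in>idx y. \<alpha>, \<lambda>\<alpha>\<in>idx y. Ident C (ob y \<alpha>)) \<in> transformations C \<kappa> y y"
    unfolding transformations_def
    using y_bond[OF _ _ idx_refl(2)] bond_refl(2) comp_id[OF y_bond] id_comp[OF y_bond] by auto
qed

text \<open>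
  This is the criterion through which chains of links become isomorphisms.  The hypothesis \<open>mono\<close> says
  that \<open>F\<close> is a monomorphism after passing to a later index of \<open>x\<close>, and \<open>cover\<close> says that every bonding
  arrow of \<open>y\<close> eventually factors through \<open>F\<close>.  The inverse sends \<open>\<eta>\<close> to such a factor \<open>y\<^sub>\<eta> \<rightarrow> x\<^sub>\<theta>\<close>.
  Choosing the factors independently would not give a natural family.  A factor pushed so far
  along \<open>x\<close> that \<open>mono\<close> applies is however determined by \<open>\<eta>\<close> and \<open>\<theta>\<close> (\<open>stable_unique\<close>), and such
  stable factors are closed under composition with bonding arrows on either side.  Taking the
  least possible \<open>\<theta>\<close> for each \<open>\<eta>\<close> therefore gives a monotone map and a natural family.
\<close>

lemma transformation_is_iso:
  assumes t: "(\<phi>, F) \<in> transformations C \<kappa> x y"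
    and mono: "\<And>\<xi>. \<xi> \<in> idx x \<Longrightarrow> \<exists>\<theta>\<in>idx x. (\<xi>, \<theta>) \<in> \<kappa> \<and>
      (\<forall>a. \<forall>h\<in>homset C a (ob x \<xi>). \<forall>k\<in>homset C a (ob x \<xi>).
        F \<xi> \<bullet>\<^bsub>C\<^esub> h = F \<xi> \<bullet>\<^bsub>C\<^esub> k \<longrightarrow> bond x (\<xi>, \<theta>) \<bullet>\<^bsub>C\<^esub> h = bond x (\<xi>, \<theta>) \<bullet>\<^bsub>C\<^esub> k)"
    and cover: "\<And>\<eta>. \<eta> \<in> idx y \<Longrightarrow> \<exists>\<xi>\<in>idx x. (\<eta>, \<phi> \<xi>) \<in> \<kappa> \<and>
      (\<exists>g\<in>homset C (ob y \<eta>) (ob x \<xi>). F \<xi> \<bullet>\<^bsub>C\<^esub> g = bond y (\<eta>, \<phi> \<xi>))"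
  shows "trans_class C \<kappa> x y (\<phi>, F) \<in> seq_isos C \<kappa> x y"
proof -
  have \<phi>: "\<phi> \<xi> \<in> idx y" "F \<xi> \<in> homset C (ob x \<xi>) (ob y (\<phi> \<xi>))" if "\<xi> \<in> idx x" for \<xi>
    using t that by (auto simp: transformations_def)
  have nat: "(\<phi> \<xi>, \<phi> \<theta>) \<in> \<kappa>" "F \<theta> \<bullet>\<^bsub>C\<^esub> bond x (\<xi>, \<theta>) = bond y (\<phi> \<xi>, \<phi> \<theta>) \<bullet>\<^bsub>C\<^esub> F \<xi>"
    if "\<xi> \<in> idx x" "\<theta> \<in> idx x" "(\<xi>, \<theta>) \<in> \<kappa>" for \<xi> \<theta>
    using t that by (auto simp: transformations_def)
  have move: "F \<theta> \<bullet>\<^bsub>C\<^esub> (bond x (\<xi>, \<theta>) \<bullet>\<^bsub>C\<^esub> h) = bond y (\<phi> \<xi>, \<phi> \<theta>) \<bullet>\<^bsub>C\<^esub> (F \<xi> \<bullet>\<^bsub>C\<^esub> h)"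
    if i: "\<xi> \<in> idx x" "\<theta> \<in> idx x" "(\<xi>, \<theta>) \<in> \<kappa>" and h: "h \<in> homset C a (ob x \<xi>)" for \<xi> \<theta> h a
    using comp_assoc[OF h x_bond[OF i] \<phi>(2)[OF i(2)]] nat(2)[OF i]
      comp_assoc[OF h \<phi>(2)[OF i(1)] y_bond[OF \<phi>(1)[OF i(1)] \<phi>(1)[OF i(2)] nat(1)[OF i]]] by simp

  define lift where "lift \<eta> \<xi> g \<longleftrightarrow> \<xi> \<in> idx x \<and> (\<eta>, \<phi> \<xi>) \<in> \<kappa> \<and> g \<in> homset C (ob y \<eta>) (ob x \<xi>) \<and>
    F \<xi> \<bullet>\<^bsub>C\<^esub> g = bond y (\<eta>, \<phi> \<xi>)" for \<eta> \<xi> g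
  define sep where "sep \<xi> \<theta> \<longleftrightarrow> \<xi> \<in> idx x \<and> \<theta> \<in> idx x \<and> (\<xi>, \<theta>) \<in> \<kappa> \<and>
      (\<forall>a. \<forall>h\<in>homset C a (ob x \<xi>). \<forall>k\<in>homset C a (ob x \<xi>).
        F \<xi> \<bullet>\<^bsub>C\<^esub> h = F \<xi> \<bullet>\<^bsub>C\<^esub> k \<longrightarrow> bond x (\<xi>, \<theta>) \<bullet>\<^bsub>C\<^esub> h = bond x (\<xi>, \<theta>) \<bullet>\<^bsub>C\<^esub> k)" for \<xi> \<theta>
  define stable where "stable \<eta> \<theta> g \<longleftrightarrow> (\<exists>\<xi> h. lift \<eta> \<xi> h \<and> sep \<xi> \<theta> \<and> g = bond x (\<xi>, \<theta>) \<bullet>\<^bsub>C\<^esub> h)"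
    for \<eta> \<theta> g

  have lift_push: "lift \<eta> \<theta> (bond x (\<xi>, \<theta>) \<bullet>\<^bsub>C\<^esub> g)"
    if l: "lift \<eta> \<xi> g" and e: "\<eta> \<in> idx y" and i: "\<theta> \<in> idx x" "(\<xi>, \<theta>) \<in> \<kappa>" for \<eta> \<xi> \<theta> g
  proof -
    have j: "\<xi> \<in> idx x" and h: "g \<in> homset C (ob y \<eta>) (ob x \<xi>)" and o: "(\<eta>, \<phi> \<xi>) \<in> \<kappa>"
      and eq: "F \<xi> \<bullet>\<^bsub>C\<^esub> g = bond y (\<eta>, \<phi> \<xi>)"
      using l by (auto simp: lift_def)
    have "F \<theta> \<bullet>\<^bsub>C\<^esub> (bond x (\<xi>, \<theta>) \<bullet>\<^bsub>C\<^esub> g) = bond y (\<eta>, \<phi> \<theta>)"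
      using move[OF j i h] bond_bond[OF y_seq e \<phi>(1)[OF j] \<phi>(1)[OF i(1)] o nat(1)[OF j i]] eq by simp
    then show ?thesis
      using comp_hom[OF h x_bond[OF j i]] ord_trans[OF o nat(1)[OF j i]] i(1) by (simp add: lift_def)
  qed
  have lift_pull: "lift \<eta> \<xi> (g \<bullet>\<^bsub>C\<^esub> bond y (\<eta>, \<zeta>))"
    if l: "lift \<zeta> \<xi> g" and e: "\<eta> \<in> idx y" "\<zeta> \<in> idx y" "(\<eta>, \<zeta>) \<in> \<kappa>" for \<eta> \<zeta> \<xi> g
  proof -
    have j: "\<xi> \<in> idx x" and h: "g \<in> homset C (ob y \<zeta>) (ob x \<xi>)" and o: "(\<zeta>, \<phi> \<xi>) \<in> \<kappa>"
      and eq: "F \<xi> \<bullet>\<^bsub>C\<^esub> g = bond y (\<zeta>, \<phi> \<xi>)"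
      using l by (auto simp: lift_def)
    have "F \<xi> \<bullet>\<^bsub>C\<^esub> (g \<bullet>\<^bsub>C\<^esub> bond y (\<eta>, \<zeta>)) = bond y (\<eta>, \<phi> \<xi>)"
      using comp_assoc[OF y_bond[OF e] h \<phi>(2)[OF j]] bond_bond[OF y_seq e(1,2) \<phi>(1)[OF j] e(3) o] eq
      by simp
    then show ?thesis
      using comp_hom[OF y_bond[OF e] h] ord_trans[OF e(3) o] j by (simp add: lift_def)
  qed
  have sep_push: "sep \<xi> \<theta>'" if s: "sep \<xi> \<theta>" and i: "\<theta>' \<in> idx x" "(\<theta>, \<theta>') \<in> \<kappa>" for \<xi> \<theta> \<theta>'
  proof -
    have j: "\<xi> \<in> idx x" "\<theta> \<in> idx x" "(\<xi>, \<theta>) \<in> \<kappa>" using s by (auto simp: sep_def)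
    have "bond x (\<xi>, \<theta>') \<bullet>\<^bsub>C\<^esub> h = bond x (\<xi>, \<theta>') \<bullet>\<^bsub>C\<^esub> k"
      if "h \<in> homset C a (ob x \<xi>)" "k \<in> homset C a (ob x \<xi>)" "F \<xi> \<bullet>\<^bsub>C\<^esub> h = F \<xi> \<bullet>\<^bsub>C\<^esub> k" for a h k
    proof -
      have "bond x (\<xi>, \<theta>) \<bullet>\<^bsub>C\<^esub> h = bond x (\<xi>, \<theta>) \<bullet>\<^bsub>C\<^esub> k"
        using s that unfolding sep_def by blast
      then show ?thesis
        by (simp only: x_push[OF j(1,2) i(1) j(3) i(2) that(1)] x_push[OF j(1,2) i(1) j(3) i(2) that(2)])
    qed
    then show ?thesis using i j ord_trans[OF j(3) i(2)] unfolding sep_def by blast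
  qed
  have stable_lift: "lift \<eta> \<theta> g" if "stable \<eta> \<theta> g" "\<eta> \<in> idx y" for \<eta> \<theta> g
    using that lift_push unfolding stable_def sep_def by blast
  have stable_push: "stable \<eta> \<theta>' (bond x (\<theta>, \<theta>') \<bullet>\<^bsub>C\<^esub> g)"
    if st: "stable \<eta> \<theta> g" and i: "\<theta>' \<in> idx x" "(\<theta>, \<theta>') \<in> \<kappa>" for \<eta> \<theta> \<theta>' g
  proof -
    obtain \<xi> h where l: "lift \<eta> \<xi> h" "sep \<xi> \<theta>" "g = bond x (\<xi>, \<theta>) \<bullet>\<^bsub>C\<^esub> h"
      using st by (auto simp: stable_def)
    have "bond x (\<theta>, \<theta>') \<bullet>\<^bsub>C\<^esub> g = bond x (\<xi>, \<theta>') \<bullet>\<^bsub>C\<^esub> h"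
      unfolding l(3) by (rule x_push[symmetric]) (use l i in \<open>auto simp: lift_def sep_def\<close>)
    then show ?thesis using l(1) sep_push[OF l(2) i] by (auto simp: stable_def)
  qed
  have stable_pull: "stable \<eta> \<theta> (g \<bullet>\<^bsub>C\<^esub> bond y (\<eta>, \<zeta>))"
    if st: "stable \<zeta> \<theta> g" and e: "\<eta> \<in> idx y" "\<zeta> \<in> idx y" "(\<eta>, \<zeta>) \<in> \<kappa>" for \<eta> \<zeta> \<theta> g
  proof -
    obtain \<xi> h where l: "lift \<zeta> \<xi> h" "sep \<xi> \<theta>" "g = bond x (\<xi>, \<theta>) \<bullet>\<^bsub>C\<^esub> h"
      using st by (auto simp: stable_def)
    have "g \<bullet>\<^bsub>C\<^esub> bond y (\<eta>, \<zeta>) = bond x (\<xi>, \<theta>) \<bullet>\<^bsub>C\<^esub> (h \<bullet>\<^bsub>C\<^esub> bond y (\<eta>, \<zeta>))"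
      unfolding l(3) using l(1,2)
      by (intro comp_assoc[symmetric, OF y_bond[OF e] _ x_bond]) (auto simp: lift_def sep_def)
    then show ?thesis using lift_pull[OF l(1) e] l(2) by (auto simp: stable_def)
  qed
  have stable_unique_le: "g = g'"
    if "lift \<eta> \<xi> h" "sep \<xi> \<theta>" "g = bond x (\<xi>, \<theta>) \<bullet>\<^bsub>C\<^esub> h"
      "lift \<eta> \<xi>' h'" "sep \<xi>' \<theta>" "g' = bond x (\<xi>', \<theta>) \<bullet>\<^bsub>C\<^esub> h'" "\<eta> \<in> idx y" "(\<xi>, \<xi>') \<in> \<kappa>"
    for \<eta> \<theta> g g' \<xi> \<xi>' h h'
  proof -
    have i: "\<xi> \<in> idx x" "\<xi>' \<in> idx x" "\<theta> \<in> idx x" "(\<xi>', \<theta>) \<in> \<kappa>" "h \<in> homset C (ob y \<eta>) (ob x \<xi>)"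
      using that by (auto simp: lift_def sep_def)
    have "bond x (\<xi>', \<theta>) \<bullet>\<^bsub>C\<^esub> (bond x (\<xi>, \<xi>') \<bullet>\<^bsub>C\<^esub> h) = bond x (\<xi>', \<theta>) \<bullet>\<^bsub>C\<^esub> h'"
    proof -
      have "F \<xi>' \<bullet>\<^bsub>C\<^esub> (bond x (\<xi>, \<xi>') \<bullet>\<^bsub>C\<^esub> h) = F \<xi>' \<bullet>\<^bsub>C\<^esub> h'"
        "bond x (\<xi>, \<xi>') \<bullet>\<^bsub>C\<^esub> h \<in> homset C (ob y \<eta>) (ob x \<xi>')" "h' \<in> homset C (ob y \<eta>) (ob x \<xi>')"
        using lift_push[OF that(1,7) i(2) that(8)] that(4) unfolding lift_def by auto
      then show ?thesis using that(5) unfolding sep_def by blast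
    qed
    then show ?thesis
      using x_push[OF i(1-3) that(8) i(4,5)] that(3,6) by simp
  qed
  have stable_unique: "g = g'" if st: "stable \<eta> \<theta> g" "stable \<eta> \<theta> g'" and e: "\<eta> \<in> idx y" for \<eta> \<theta> g g'
  proof -
    obtain \<xi> h where l: "lift \<eta> \<xi> h" "sep \<xi> \<theta>" "g = bond x (\<xi>, \<theta>) \<bullet>\<^bsub>C\<^esub> h"
      using st by (auto simp: stable_def)
    obtain \<xi>' h' where l': "lift \<eta> \<xi>' h'" "sep \<xi>' \<theta>" "g' = bond x (\<xi>', \<theta>) \<bullet>\<^bsub>C\<^esub> h'"
      using st by (auto simp: stable_def)
    have "(\<xi>, \<xi>') \<in> \<kappa> \<or> (\<xi>', \<xi>) \<in> \<kappa>"
      using l l' by (intro x_total) (auto simp: lift_def)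
    then show ?thesis
      using stable_unique_le[OF l l' e] stable_unique_le[OF l' l e] by blast
  qed
  have stable_ex: "\<exists>\<theta>\<in>idx x. \<exists>g. stable \<eta> \<theta> g" if e: "\<eta> \<in> idx y" for \<eta>
  proof -
    obtain \<xi> h where l: "lift \<eta> \<xi> h" using cover[OF e] by (auto simp: lift_def)
    then have "\<xi> \<in> idx x" by (simp add: lift_def)
    then obtain \<theta> where "sep \<xi> \<theta>" using mono[of \<xi>] unfolding sep_def by blast
    with l show ?thesis unfolding stable_def sep_def by blast
  qed

  define \<psi> where "\<psi> \<eta> = wo_rel.minim \<kappa> {\<theta> \<in> idx x. \<exists>g. stable \<eta> \<theta> g}" for \<eta>
  define G where "G \<eta> = (SOME g. stable \<eta> (\<psi> \<eta>) g)" for \<eta>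
  have \<psi>_in: "\<psi> \<eta> \<in> {\<theta> \<in> idx x. \<exists>g. stable \<eta> \<theta> g}" if "\<eta> \<in> idx y" for \<eta>
    unfolding \<psi>_def by (rule wo_rel.minim_in[OF wo]) (use idx_Field stable_ex[OF that] in auto)
  have \<psi>_least: "(\<psi> \<eta>, \<theta>) \<in> \<kappa>" if "stable \<eta> \<theta> g" for \<eta> \<theta> g
    unfolding \<psi>_def
  proof (rule wo_rel.minim_least[OF wo])
    have "\<theta> \<in> idx x" using that by (auto simp: stable_def sep_def)
    then show "\<theta> \<in> {\<theta> \<in> idx x. \<exists>g. stable \<eta> \<theta> g}" using that by auto
  qed (use idx_Field in auto)
  have G: "stable \<eta> (\<psi> \<eta>) (G \<eta>)" if "\<eta> \<in> idx y" for \<eta>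
    unfolding G_def by (rule someI_ex) (use \<psi>_in[OF that] in auto)
  have \<psi>_idx: "\<psi> \<eta> \<in> idx x" if "\<eta> \<in> idx y" for \<eta> using \<psi>_in[OF that] by simp
  have GL: "G \<eta> \<in> homset C (ob y \<eta>) (ob x (\<psi> \<eta>))" "(\<eta>, \<phi> (\<psi> \<eta>)) \<in> \<kappa>"
    "F (\<psi> \<eta>) \<bullet>\<^bsub>C\<^esub> G \<eta> = bond y (\<eta>, \<phi> (\<psi> \<eta>))" if "\<eta> \<in> idx y" for \<eta>
    using stable_lift[OF G[OF that] that] by (auto simp: lift_def)
  have \<psi>_mono: "(\<psi> \<eta>, \<psi> \<zeta>) \<in> \<kappa>" if "\<eta> \<in> idx y" "\<zeta> \<in> idx y" "(\<eta>, \<zeta>) \<in> \<kappa>" for \<eta> \<zeta>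
    by (rule \<psi>_least[OF stable_pull[OF G[OF that(2)] that]])
  have G_nat: "G \<zeta> \<bullet>\<^bsub>C\<^esub> bond y (\<eta>, \<zeta>) = bond x (\<psi> \<eta>, \<psi> \<zeta>) \<bullet>\<^bsub>C\<^esub> G \<eta>"
    if "\<eta> \<in> idx y" "\<zeta> \<in> idx y" "(\<eta>, \<zeta>) \<in> \<kappa>" for \<eta> \<zeta>
    by (rule stable_unique[OF stable_pull[OF G[OF that(2)] that]
          stable_push[OF G[OF that(1)] \<psi>_idx[OF that(2)] \<psi>_mono[OF that]] that(1)])
  let ?s = "(\<lambda>\<eta>\<in>idx y. \<psi> \<eta>, \<lambda>\<eta>\<in>idx y. G \<eta>)"
  have s: "?s \<in> transformations C \<kappa> y x"
    unfolding transformations_def using \<psi>_idx \<psi>_mono GL(1) G_nat by simp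
  have gf: "(trans_comp C x ?s (\<phi>, F), (\<lambda>\<alpha>\<in>idx x. \<alpha>, \<lambda>\<alpha>\<in>idx x. Ident C (ob x \<alpha>)))
      \<in> trans_equiv C \<kappa> x x"
  proof -
    have "\<exists>\<gamma>\<in>idx x. (\<psi> (\<phi> \<xi>), \<gamma>) \<in> \<kappa> \<and> (\<xi>, \<gamma>) \<in> \<kappa> \<and>
      bond x (\<psi> (\<phi> \<xi>), \<gamma>) \<bullet>\<^bsub>C\<^esub> (G (\<phi> \<xi>) \<bullet>\<^bsub>C\<^esub> F \<xi>) = bond x (\<xi>, \<gamma>) \<bullet>\<^bsub>C\<^esub> Ident C (ob x \<xi>)"
      if i: "\<xi> \<in> idx x" for \<xi>
    proof -
      let ?\<eta> = "\<phi> \<xi>" let ?\<zeta> = "\<psi> (\<phi> \<xi>)"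
      note e = \<phi>(1)[OF i] and z = \<psi>_idx[OF \<phi>(1)[OF i]]
      have GF: "G ?\<eta> \<bullet>\<^bsub>C\<^esub> F \<xi> \<in> homset C (ob x \<xi>) (ob x ?\<zeta>)"
        by (rule comp_hom[OF \<phi>(2)[OF i] GL(1)[OF e]])
      obtain \<theta> where th: "\<theta> \<in> idx x" "(\<xi>, \<theta>) \<in> \<kappa>" "(?\<zeta>, \<theta>) \<in> \<kappa>"
        using x_total[OF i z] idx_refl(1) i z by blast
      obtain \<gamma> where g: "sep \<theta> \<gamma>" using mono[OF th(1)] th(1) unfolding sep_def by blast
      then have gi: "\<gamma> \<in> idx x" "(\<theta>, \<gamma>) \<in> \<kappa>" by (auto simp: sep_def)
      \<comment> \<open>Both \<open>G \<circ> F\<close> and the identity, moved to \<open>\<theta>\<close>, have the same image under \<open>F\<close>;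
        by the choice of \<open>\<gamma>\<close> they agree once they are moved on to \<open>\<gamma>\<close>.\<close>
      have "F \<theta> \<bullet>\<^bsub>C\<^esub> (bond x (?\<zeta>, \<theta>) \<bullet>\<^bsub>C\<^esub> (G ?\<eta> \<bullet>\<^bsub>C\<^esub> F \<xi>)) =
          bond y (\<phi> ?\<zeta>, \<phi> \<theta>) \<bullet>\<^bsub>C\<^esub> (F ?\<zeta> \<bullet>\<^bsub>C\<^esub> (G ?\<eta> \<bullet>\<^bsub>C\<^esub> F \<xi>))"
        by (rule move[OF z th(1,3) GF])
      also have "F ?\<zeta> \<bullet>\<^bsub>C\<^esub> (G ?\<eta> \<bullet>\<^bsub>C\<^esub> F \<xi>) = bond y (?\<eta>, \<phi> ?\<zeta>) \<bullet>\<^bsub>C\<^esub> F \<xi>"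
        unfolding comp_assoc[OF \<phi>(2)[OF i] GL(1)[OF e] \<phi>(2)[OF z]] GL(3)[OF e] ..
      also have "bond y (\<phi> ?\<zeta>, \<phi> \<theta>) \<bullet>\<^bsub>C\<^esub> (bond y (?\<eta>, \<phi> ?\<zeta>) \<bullet>\<^bsub>C\<^esub> F \<xi>) = bond y (?\<eta>, \<phi> \<theta>) \<bullet>\<^bsub>C\<^esub> F \<xi>"
        by (rule y_push[symmetric, OF e \<phi>(1)[OF z] \<phi>(1)[OF th(1)] GL(2)[OF e]
              nat(1)[OF z th(1,3)] \<phi>(2)[OF i]])
      also have "\<dots> = F \<theta> \<bullet>\<^bsub>C\<^esub> bond x (\<xi>, \<theta>)"
        by (rule nat(2)[symmetric, OF i th(1,2)])
      finally have "bond x (\<theta>, \<gamma>) \<bullet>\<^bsub>C\<^esub> (bond x (?\<zeta>, \<theta>) \<bullet>\<^bsub>C\<^esub> (G ?\<eta> \<bullet>\<^bsub>C\<^esub> F \<xi>)) =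
          bond x (\<theta>, \<gamma>) \<bullet>\<^bsub>C\<^esub> bond x (\<xi>, \<theta>)"
        using g comp_hom[OF GF x_bond[OF z th(1,3)]] x_bond[OF i th(1,2)] unfolding sep_def by blast
      then have "bond x (?\<zeta>, \<gamma>) \<bullet>\<^bsub>C\<^esub> (G ?\<eta> \<bullet>\<^bsub>C\<^esub> F \<xi>) = bond x (\<xi>, \<gamma>)"
        by (simp only: x_push[OF z th(1) gi(1) th(3) gi(2) GF]
            bond_bond[OF x_seq i th(1) gi(1) th(2) gi(2)])
      then show ?thesis
        using gi ord_trans[OF th(2) gi(2)] ord_trans[OF th(3) gi(2)]
          comp_id[OF x_bond[OF i gi(1)]] by auto
    qed
    then show ?thesis
      using trans_comp_closed[OF cat x_seq y_seq x_seq t s] ident_transformation(1) \<phi>(1)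
      unfolding trans_equiv_def trans_comp_def by auto
  qed
  have fg: "(trans_comp C y (\<phi>, F) ?s, (\<lambda>\<alpha>\<in>idx y. \<alpha>, \<lambda>\<alpha>\<in>idx y. Ident C (ob y \<alpha>)))
      \<in> trans_equiv C \<kappa> y y"
  proof -
    have "\<exists>\<gamma>\<in>idx y. (\<phi> (\<psi> \<eta>), \<gamma>) \<in> \<kappa> \<and> (\<eta>, \<gamma>) \<in> \<kappa> \<and>
      bond y (\<phi> (\<psi> \<eta>), \<gamma>) \<bullet>\<^bsub>C\<^esub> (F (\<psi> \<eta>) \<bullet>\<^bsub>C\<^esub> G \<eta>) = bond y (\<eta>, \<gamma>) \<bullet>\<^bsub>C\<^esub> Ident C (ob y \<eta>)"
      if e: "\<eta> \<in> idx y" for \<eta>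
      using \<phi>(1)[OF \<psi>_idx[OF e]] GL(2,3)[OF e] idx_refl(2) comp_id[OF y_bond[OF e]]
        id_comp[OF y_bond[OF e]] bond_refl(2) by (intro bexI[of _ "\<phi> (\<psi> \<eta>)"]) auto
    then show ?thesis
      using trans_comp_closed[OF cat y_seq x_seq y_seq s t] ident_transformation(2)
      unfolding trans_equiv_def trans_comp_def by auto
  qed
  show ?thesis by (rule iso_classI[OF s t gf fg])
qed

end

section \<open>Chains of links\<close>

datatype ('k, 'a) link = Link (src: 'k) (tgt: 'k) (arr: 'a)

context sequence_pair
begin

definition links :: "('k, 'a) link set" where
  "links = {t. src t \<in> idx x \<and> tgt t \<in> idx y \<and> arr t \<in> homset C (ob x (src t)) (ob y (tgt t))}"

definition prec :: "('k, 'a) link \<Rightarrow> ('k, 'a) link \<Rightarrow> bool"  (infix \<open>\<prec>\<close> 50) where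
  "s \<prec> t \<longleftrightarrow> src s \<noteq> src t \<and> (src s, src t) \<in> \<kappa> \<and> tgt s \<noteq> tgt t \<and> (tgt s, tgt t) \<in> \<kappa> \<and>
     (\<exists>g\<in>homset C (ob y (tgt s)) (ob x (src t)).
        g \<bullet>\<^bsub>C\<^esub> arr s = bond x (src s, src t) \<and> arr t \<bullet>\<^bsub>C\<^esub> g = bond y (tgt s, tgt t))"

lemma linkD:
  assumes "t \<in> links"
  shows "src t \<in> idx x" "tgt t \<in> idx y" "arr t \<in> homset C (ob x (src t)) (ob y (tgt t))"
  using assms by (auto simp: links_def)

lemma prec_natural:
  assumes s: "s \<in> links" and t: "t \<in> links" and st: "s \<prec> t"
  shows "arr t \<bullet>\<^bsub>C\<^esub> bond x (src s, src t) = bond y (tgt s, tgt t) \<bullet>\<^bsub>C\<^esub> arr s"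
proof -
  obtain g where g: "g \<in> homset C (ob y (tgt s)) (ob x (src t))"
    "g \<bullet>\<^bsub>C\<^esub> arr s = bond x (src s, src t)" "arr t \<bullet>\<^bsub>C\<^esub> g = bond y (tgt s, tgt t)"
    using st by (auto simp: prec_def)
  show ?thesis
    using comp_assoc[OF linkD(3)[OF s] g(1) linkD(3)[OF t]] g(2,3) by simp
qed

text \<open>
  The arrow back from \<open>r\<close> to \<open>s\<close>, followed by a bonding arrow, also serves as the arrow back from \<open>r\<close>
  to \<open>t\<close>.  From \<open>s\<close> to \<open>t\<close> only a commuting square is required: this is what the limit
  operator provides, whereas \<open>s \<prec> t\<close> would already need an arrow back into the limit object.
\<close>

lemma prec_square:
  assumes r: "r \<in> links" and s: "s \<in> links" and t: "t \<in> links" and rs: "r \<prec> s"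
    and o: "(src s, src t) \<in> \<kappa>" "(tgt s, tgt t) \<in> \<kappa>"
    and square: "arr t \<bullet>\<^bsub>C\<^esub> bond x (src s, src t) = bond y (tgt s, tgt t) \<bullet>\<^bsub>C\<^esub> arr s"
  shows "r \<prec> t"
proof -
  obtain g where g: "g \<in> homset C (ob y (tgt r)) (ob x (src s))"
    "g \<bullet>\<^bsub>C\<^esub> arr r = bond x (src r, src s)" "arr s \<bullet>\<^bsub>C\<^esub> g = bond y (tgt r, tgt s)"
    using rs by (auto simp: prec_def)
  have o': "(src r, src s) \<in> \<kappa>" "(tgt r, tgt s) \<in> \<kappa>"
    using rs by (auto simp: prec_def)
  have strict: "src r \<noteq> src t" "tgt r \<noteq> tgt t"
    using rs o ord_antisym unfolding prec_def by metis+
  note xb = x_bond[OF linkD(1)[OF s] linkD(1)[OF t] o(1)]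
  note yb = y_bond[OF linkD(2)[OF s] linkD(2)[OF t] o(2)]
  let ?g = "bond x (src s, src t) \<bullet>\<^bsub>C\<^esub> g"
  have "?g \<bullet>\<^bsub>C\<^esub> arr r = bond x (src r, src t)"
    using comp_assoc[OF linkD(3)[OF r] g(1) xb] g(2)
      bond_bond[OF x_seq linkD(1)[OF r] linkD(1)[OF s] linkD(1)[OF t] o'(1) o(1)] by simp
  moreover have "arr t \<bullet>\<^bsub>C\<^esub> ?g = bond y (tgt r, tgt t)"
    using comp_assoc[OF g(1) xb linkD(3)[OF t]] comp_assoc[OF g(1) linkD(3)[OF s] yb] g(3) square
      bond_bond[OF y_seq linkD(2)[OF r] linkD(2)[OF s] linkD(2)[OF t] o'(2) o(2)] by simp
  ultimately show ?thesis
    using comp_hom[OF g(1) xb] strict ord_trans[OF o'(1) o(1)] ord_trans[OF o'(2) o(2)]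
    unfolding prec_def by blast
qed

lemma prec_trans:
  assumes "r \<in> links" "s \<in> links" "t \<in> links" "r \<prec> s" "s \<prec> t"
  shows "r \<prec> t"
  using prec_square[OF assms(1-4)] prec_natural[OF assms(2,3,5)] assms(5) by (auto simp: prec_def)

text \<open>
  A chain of links gives arrows only at the sources of its members.  An index \<open>\<xi>\<close> of \<open>x\<close> is first
  moved up to the least source above it; least sources are monotone in \<open>\<xi>\<close>, so the squares
  between members of the chain give naturality.  The arrows back supply the two hypotheses
  of the criterion for isomorphisms: an arrow \<open>g\<close> back from \<open>t\<close> is a left inverse of \<open>arr t\<close> up to
  a bonding arrow of \<open>x\<close>, and the arrow of the next link is a left inverse of \<open>g\<close> up to
  a bonding arrow of \<open>y\<close>.
\<close>

lemma cofinal_chain_iso: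
  assumes T: "T \<subseteq> links"
    and chain: "\<And>s t. s \<in> T \<Longrightarrow> t \<in> T \<Longrightarrow> s = t \<or> s \<prec> t \<or> t \<prec> s"
    and no_max: "\<And>t. t \<in> T \<Longrightarrow> \<exists>s\<in>T. t \<prec> s"
    and cof_x: "\<And>\<xi>. \<xi> \<in> idx x \<Longrightarrow> \<exists>t\<in>T. (\<xi>, src t) \<in> \<kappa>"
    and cof_y: "\<And>\<eta>. \<eta> \<in> idx y \<Longrightarrow> \<exists>t\<in>T. (\<eta>, tgt t) \<in> \<kappa>"
  obtains \<phi> F where "(\<phi>, F) \<in> transformations C \<kappa> x y"
    "trans_class C \<kappa> x y (\<phi>, F) \<in> seq_isos C \<kappa> x y"
    "\<And>t. t \<in> T \<Longrightarrow> \<phi> (src t) = tgt t \<and> F (src t) = arr t"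
proof -
  have L: "src t \<in> idx x" "tgt t \<in> idx y" "arr t \<in> homset C (ob x (src t)) (ob y (tgt t))"
    if "t \<in> T" for t using T that linkD by auto
  have le_chain: "s = t \<or> s \<prec> t" if "s \<in> T" "t \<in> T" "(src s, src t) \<in> \<kappa>" for s t
    using chain[OF that(1,2)] that(3) ord_antisym unfolding prec_def by metis
  define first where "first \<xi> t \<longleftrightarrow> t \<in> T \<and> (\<xi>, src t) \<in> \<kappa> \<and>
    (\<forall>s\<in>T. (\<xi>, src s) \<in> \<kappa> \<longrightarrow> (src t, src s) \<in> \<kappa>)" for \<xi> t
  define \<tau> where "\<tau> \<xi> = (SOME t. first \<xi> t)" for \<xi>
  have first_ex: "\<exists>t. first \<xi> t" if i: "\<xi> \<in> idx x" for \<xi>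
  proof -
    let ?S = "src ` {t \<in> T. (\<xi>, src t) \<in> \<kappa>}"
    have sub: "?S \<subseteq> Field \<kappa>" using L(1) idx_Field(1) by auto
    have ne: "?S \<noteq> {}" using cof_x[OF i] by auto
    obtain t where t: "t \<in> T" "(\<xi>, src t) \<in> \<kappa>" "src t = wo_rel.minim \<kappa> ?S"
      using wo_rel.minim_in[OF wo sub ne] by auto
    show ?thesis
      using t wo_rel.minim_least[OF wo sub] unfolding first_def by (intro exI[of _ t]) auto
  qed
  have \<tau>: "\<tau> \<xi> \<in> T" "(\<xi>, src (\<tau> \<xi>)) \<in> \<kappa>"
    "\<And>s. s \<in> T \<Longrightarrow> (\<xi>, src s) \<in> \<kappa> \<Longrightarrow> (src (\<tau> \<xi>), src s) \<in> \<kappa>" if "\<xi> \<in> idx x" for \<xi>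
    using someI_ex[OF first_ex[OF that]] unfolding \<tau>_def first_def by auto
  have \<tau>_src: "\<tau> (src t) = t" if t: "t \<in> T" for t
  proof -
    note i = L(1)[OF t]
    have "src (\<tau> (src t)) = src t"
      using \<tau>(2)[OF i] \<tau>(3)[OF i t idx_refl(1)[OF i]] ord_antisym by blast
    then show ?thesis using chain[OF \<tau>(1)[OF i] t] unfolding prec_def by metis
  qed
  have \<tau>_mono: "\<tau> \<xi> = \<tau> \<theta> \<or> \<tau> \<xi> \<prec> \<tau> \<theta>" if "\<xi> \<in> idx x" "\<theta> \<in> idx x" "(\<xi>, \<theta>) \<in> \<kappa>" for \<xi> \<theta>
    using le_chain \<tau>(1,3)[OF that(1)] \<tau>(1,2)[OF that(2)] ord_trans that(3) by blast

  define \<phi> where "\<phi> = (\<lambda>\<xi>\<in>idx x. tgt (\<tau> \<xi>))"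
  define F where "F = (\<lambda>\<xi>\<in>idx x. arr (\<tau> \<xi>) \<bullet>\<^bsub>C\<^esub> bond x (\<xi>, src (\<tau> \<xi>)))"
  have step: "bond x (\<xi>, src (\<tau> \<xi>)) \<in> homset C (ob x \<xi>) (ob x (src (\<tau> \<xi>)))" if "\<xi> \<in> idx x" for \<xi>
    by (rule x_bond[OF that L(1)[OF \<tau>(1)[OF that]] \<tau>(2)[OF that]])
  have mono: "(tgt (\<tau> \<xi>), tgt (\<tau> \<theta>)) \<in> \<kappa>" "(src (\<tau> \<xi>), src (\<tau> \<theta>)) \<in> \<kappa>"
    "arr (\<tau> \<theta>) \<bullet>\<^bsub>C\<^esub> bond x (src (\<tau> \<xi>), src (\<tau> \<theta>)) = bond y (tgt (\<tau> \<xi>), tgt (\<tau> \<theta>)) \<bullet>\<^bsub>C\<^esub> arr (\<tau> \<xi>)"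
    if i: "\<xi> \<in> idx x" "\<theta> \<in> idx x" "(\<xi>, \<theta>) \<in> \<kappa>" for \<xi> \<theta>
  proof -
    note t = \<tau>(1)[OF i(1)] and t' = \<tau>(1)[OF i(2)]
    show "(tgt (\<tau> \<xi>), tgt (\<tau> \<theta>)) \<in> \<kappa>" "(src (\<tau> \<xi>), src (\<tau> \<theta>)) \<in> \<kappa>"
      using \<tau>_mono[OF i] idx_refl L(1,2)[OF t] unfolding prec_def by metis+
    show "arr (\<tau> \<theta>) \<bullet>\<^bsub>C\<^esub> bond x (src (\<tau> \<xi>), src (\<tau> \<theta>)) =
        bond y (tgt (\<tau> \<xi>), tgt (\<tau> \<theta>)) \<bullet>\<^bsub>C\<^esub> arr (\<tau> \<xi>)"
      using \<tau>_mono[OF i]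
    proof
      assume eq: "\<tau> \<xi> = \<tau> \<theta>"
      show ?thesis
        unfolding eq bond_refl(1)[OF L(1)[OF t']] bond_refl(2)[OF L(2)[OF t']]
        using comp_id[OF L(3)[OF t']] id_comp[OF L(3)[OF t']] by simp
    next
      assume "\<tau> \<xi> \<prec> \<tau> \<theta>"
      then show ?thesis using prec_natural t t' T by blast
    qed
  qed
  have t: "(\<phi>, F) \<in> transformations C \<kappa> x y"
  proof -
    have "(arr (\<tau> \<theta>) \<bullet>\<^bsub>C\<^esub> bond x (\<theta>, src (\<tau> \<theta>))) \<bullet>\<^bsub>C\<^esub> bond x (\<xi>, \<theta>) =
        bond y (tgt (\<tau> \<xi>), tgt (\<tau> \<theta>)) \<bullet>\<^bsub>C\<^esub> (arr (\<tau> \<xi>) \<bullet>\<^bsub>C\<^esub> bond x (\<xi>, src (\<tau> \<xi>)))"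
      if i: "\<xi> \<in> idx x" "\<theta> \<in> idx x" "(\<xi>, \<theta>) \<in> \<kappa>" for \<xi> \<theta>
    proof -
      note p = \<tau>(1)[OF i(1)] and q = \<tau>(1)[OF i(2)]
      have "(arr (\<tau> \<theta>) \<bullet>\<^bsub>C\<^esub> bond x (\<theta>, src (\<tau> \<theta>))) \<bullet>\<^bsub>C\<^esub> bond x (\<xi>, \<theta>) =
          arr (\<tau> \<theta>) \<bullet>\<^bsub>C\<^esub> bond x (\<xi>, src (\<tau> \<theta>))"
        unfolding comp_assoc[symmetric, OF x_bond[OF i] step[OF i(2)] L(3)[OF q]]
          bond_bond[OF x_seq i(1,2) L(1)[OF q] i(3) \<tau>(2)[OF i(2)]] ..
      also have "\<dots> = (arr (\<tau> \<theta>) \<bullet>\<^bsub>C\<^esub> bond x (src (\<tau> \<xi>), src (\<tau> \<theta>))) \<bullet>\<^bsub>C\<^esub> bond x (\<xi>, src (\<tau> \<xi>))"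
        unfolding comp_assoc[symmetric, OF step[OF i(1)] x_bond[OF L(1)[OF p] L(1)[OF q] mono(2)[OF i]] L(3)[OF q]]
          bond_bond[OF x_seq i(1) L(1)[OF p] L(1)[OF q] \<tau>(2)[OF i(1)] mono(2)[OF i]] ..
      also have "\<dots> = bond y (tgt (\<tau> \<xi>), tgt (\<tau> \<theta>)) \<bullet>\<^bsub>C\<^esub> (arr (\<tau> \<xi>) \<bullet>\<^bsub>C\<^esub> bond x (\<xi>, src (\<tau> \<xi>)))"
        unfolding mono(3)[OF i]
        by (rule comp_assoc[symmetric, OF step[OF i(1)] L(3)[OF p] y_bond[OF L(2)[OF p] L(2)[OF q] mono(1)[OF i]]])
      finally show ?thesis .
    qed
    then show ?thesis
      using L(2) \<tau>(1) mono(1) comp_hom[OF step L(3)]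
      unfolding transformations_def \<phi>_def F_def by auto
  qed
  have at: "\<phi> (src t) = tgt t" "F (src t) = arr t" if "t \<in> T" for t
    using L(1)[OF that] \<tau>_src[OF that] bond_refl(1)[OF L(1)[OF that]] comp_id[OF L(3)[OF that]]
    unfolding \<phi>_def F_def by auto
  have "trans_class C \<kappa> x y (\<phi>, F) \<in> seq_isos C \<kappa> x y"
  proof (rule transformation_is_iso[OF t])
    fix \<xi> assume i: "\<xi> \<in> idx x"
    note p = \<tau>(1)[OF i]
    obtain s where s: "s \<in> T" "\<tau> \<xi> \<prec> s" using no_max[OF p] by blast
    then obtain g where g: "g \<in> homset C (ob y (tgt (\<tau> \<xi>))) (ob x (src s))"
      "g \<bullet>\<^bsub>C\<^esub> arr (\<tau> \<xi>) = bond x (src (\<tau> \<xi>), src s)" "(src (\<tau> \<xi>), src s) \<in> \<kappa>"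
      by (auto simp: prec_def)
    have gF: "g \<bullet>\<^bsub>C\<^esub> F \<xi> = bond x (\<xi>, src s)"
      using comp_assoc[OF step[OF i] L(3)[OF p] g(1)] g(2)
        bond_bond[OF x_seq i L(1)[OF p] L(1)[OF s(1)] \<tau>(2)[OF i] g(3)] i by (simp add: F_def)
    have F\<xi>: "F \<xi> \<in> homset C (ob x \<xi>) (ob y (tgt (\<tau> \<xi>)))"
      using comp_hom[OF step[OF i] L(3)[OF p]] i by (simp add: F_def)
    have "bond x (\<xi>, src s) \<bullet>\<^bsub>C\<^esub> h = bond x (\<xi>, src s) \<bullet>\<^bsub>C\<^esub> k"
      if "h \<in> homset C a (ob x \<xi>)" "k \<in> homset C a (ob x \<xi>)" "F \<xi> \<bullet>\<^bsub>C\<^esub> h = F \<xi> \<bullet>\<^bsub>C\<^esub> k" for a h k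
      using comp_assoc[OF that(1) F\<xi> g(1)] comp_assoc[OF that(2) F\<xi> g(1)] that(3) gF by simp
    then show "\<exists>\<theta>\<in>idx x. (\<xi>, \<theta>) \<in> \<kappa> \<and>
      (\<forall>a. \<forall>h\<in>homset C a (ob x \<xi>). \<forall>k\<in>homset C a (ob x \<xi>).
        F \<xi> \<bullet>\<^bsub>C\<^esub> h = F \<xi> \<bullet>\<^bsub>C\<^esub> k \<longrightarrow> bond x (\<xi>, \<theta>) \<bullet>\<^bsub>C\<^esub> h = bond x (\<xi>, \<theta>) \<bullet>\<^bsub>C\<^esub> k)"
      using L(1)[OF s(1)] ord_trans[OF \<tau>(2)[OF i] g(3)] by blast
  next
    fix \<eta> assume e: "\<eta> \<in> idx y"
    obtain r where r: "r \<in> T" "(\<eta>, tgt r) \<in> \<kappa>" using cof_y[OF e] by blast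
    obtain s where s: "s \<in> T" "r \<prec> s" using no_max[OF r(1)] by blast
    then obtain g where g: "g \<in> homset C (ob y (tgt r)) (ob x (src s))"
      "arr s \<bullet>\<^bsub>C\<^esub> g = bond y (tgt r, tgt s)" "(tgt r, tgt s) \<in> \<kappa>"
      by (auto simp: prec_def)
    note yb = y_bond[OF e L(2)[OF r(1)] r(2)]
    have "F (src s) \<bullet>\<^bsub>C\<^esub> (g \<bullet>\<^bsub>C\<^esub> bond y (\<eta>, tgt r)) = bond y (\<eta>, \<phi> (src s))"
      using comp_assoc[OF yb g(1) L(3)[OF s(1)]] g(2) at[OF s(1)]
        bond_bond[OF y_seq e L(2)[OF r(1)] L(2)[OF s(1)] r(2) g(3)] by simp
    then show "\<exists>\<xi>\<in>idx x. (\<eta>, \<phi> \<xi>) \<in> \<kappa> \<and>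
      (\<exists>g\<in>homset C (ob y \<eta>) (ob x \<xi>). F \<xi> \<bullet>\<^bsub>C\<^esub> g = bond y (\<eta>, \<phi> \<xi>))"
      using L(1)[OF s(1)] at(1)[OF s(1)] ord_trans[OF r(2) g(3)] comp_hom[OF yb g(1)] by metis
  qed
  with t at show thesis using that by blast
qed

end

section \<open>Back and forth\<close>

text \<open>
  Having no largest element makes the supremum a limit ordinal and makes the strict predecessors of
  the supremum coincide with the indices below some member of \<open>S\<close>; so \<open>S\<close> is cofinal in exactly
  the initial segment to which the quasi-limiting operator is applied.
\<close>

lemma limit_sup:
  assumes wo: "wo_rel \<kappa>" and S: "S \<subseteq> Field \<kappa>" "S \<noteq> {}"
    and no_max: "\<And>s. s \<in> S \<Longrightarrow> \<exists>t\<in>S. s \<noteq> t \<and> (s, t) \<in> \<kappa>"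
    and bdd: "b \<in> Field \<kappa>" "\<And>s. s \<in> S \<Longrightarrow> (s, b) \<in> \<kappa>"
  obtains \<delta> where "limit_ord \<kappa> \<delta>" "underS \<kappa> \<delta> = {\<xi>. \<exists>s\<in>S. (\<xi>, s) \<in> \<kappa>}"
proof -
  let ?B = "{b \<in> Field \<kappa>. \<forall>s\<in>S. (s, b) \<in> \<kappa>}"
  define \<delta> where "\<delta> = wo_rel.minim \<kappa> ?B"
  have sub: "?B \<subseteq> Field \<kappa>" and ne: "?B \<noteq> {}" using bdd by auto
  have \<delta>: "\<delta> \<in> Field \<kappa>" "\<And>s. s \<in> S \<Longrightarrow> (s, \<delta>) \<in> \<kappa>"
    using wo_rel.minim_in[OF wo sub ne] unfolding \<delta>_def by auto
  have least: "(\<delta>, c) \<in> \<kappa>" if "c \<in> Field \<kappa>" "\<And>s. s \<in> S \<Longrightarrow> (s, c) \<in> \<kappa>" for c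
    unfolding \<delta>_def by (rule wo_rel.minim_least[OF wo sub]) (use that in auto)
  have anti: "a = c" if "(a, c) \<in> \<kappa>" "(c, a) \<in> \<kappa>" for a c
    using wo_rel.ANTISYM[OF wo] that by (rule antisymD)
  have tr: "(a, d) \<in> \<kappa>" if "(a, c) \<in> \<kappa>" "(c, d) \<in> \<kappa>" for a c d
    using wo_rel.TRANS[OF wo] that by (rule transD)
  have eq: "underS \<kappa> \<delta> = {\<xi>. \<exists>s\<in>S. (\<xi>, s) \<in> \<kappa>}"
  proof (intro equalityI subsetI)
    fix \<xi> assume "\<xi> \<in> underS \<kappa> \<delta>"
    then have x: "\<xi> \<noteq> \<delta>" "(\<xi>, \<delta>) \<in> \<kappa>" by (auto simp: underS_def)
    then have f: "\<xi> \<in> Field \<kappa>" by (auto simp: Field_def)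
    then obtain s where "s \<in> S" "(s, \<xi>) \<notin> \<kappa>" using least x anti by blast
    then show "\<xi> \<in> {\<xi>. \<exists>s\<in>S. (\<xi>, s) \<in> \<kappa>}" using wo_rel.TOTALS[OF wo] f S(1) by blast
  next
    fix \<xi> assume "\<xi> \<in> {\<xi>. \<exists>s\<in>S. (\<xi>, s) \<in> \<kappa>}"
    then obtain s where s: "s \<in> S" "(\<xi>, s) \<in> \<kappa>" by blast
    obtain t where t: "t \<in> S" "s \<noteq> t" "(s, t) \<in> \<kappa>" using no_max[OF s(1)] by blast
    have "\<xi> \<noteq> \<delta>" using \<delta>(2)[OF t(1)] s(2) t anti tr by blast
    then show "\<xi> \<in> underS \<kappa> \<delta>" using tr[OF s(2) \<delta>(2)[OF s(1)]] by (simp add: underS_def)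
  qed
  have "limit_ord \<kappa> \<delta>"
    unfolding limit_ord_def
  proof (intro conjI ballI)
    show "\<delta> \<in> Field \<kappa>" by (rule \<delta>(1))
    have refl: "(s, s) \<in> \<kappa>" if "s \<in> S" for s using wo_rel.TOTALS[OF wo] S(1) that by blast
    then show "underS \<kappa> \<delta> \<noteq> {}" using S(2) unfolding eq by blast
    fix \<xi> assume "\<xi> \<in> underS \<kappa> \<delta>"
    then obtain s where s: "s \<in> S" "(\<xi>, s) \<in> \<kappa>" unfolding eq by blast
    obtain t where t: "t \<in> S" "s \<noteq> t" "(s, t) \<in> \<kappa>" using no_max[OF s(1)] by blast
    have "\<xi> \<noteq> t" using s t anti by blast
    then have "\<xi> \<in> underS \<kappa> t" using tr[OF s(2) t(3)] by (simp add: underS_def)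
    then show "\<exists>\<eta>\<in>underS \<kappa> \<delta>. \<xi> \<in> underS \<kappa> \<eta>" unfolding eq using t(1) refl by blast
  qed
  then show thesis using eq that by blast
qed

text \<open>
  Boundedness depends on the cardinality of the set alone; this transfers it from the sources
  of a chain of links to the targets.
\<close>

lemma bounded_iff_card_less:
  assumes card: "Card_order \<kappa>" and inf: "infinite (Field \<kappa>)" and reg: "regularCard \<kappa>"
    and S: "S \<subseteq> Field \<kappa>"
  shows "(\<exists>b\<in>Field \<kappa>. \<forall>s\<in>S. (s, b) \<in> \<kappa>) \<longleftrightarrow> |S| <o \<kappa>"
proof
  have wo: "wo_rel \<kappa>" using card by (simp add: wo_rel_def card_order_on_def)
  assume "\<exists>b\<in>Field \<kappa>. \<forall>s\<in>S. (s, b) \<in> \<kappa>"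
  then obtain b where b: "b \<in> Field \<kappa>" "\<And>s. s \<in> S \<Longrightarrow> (s, b) \<in> \<kappa>" by blast
  obtain c where c: "c \<in> Field \<kappa>" "b \<noteq> c" "(b, c) \<in> \<kappa>"
    using infinite_Card_order_limit[OF card inf b(1)] by blast
  have "S \<subseteq> underS \<kappa> c"
    using b c wo_rel.TRANS[OF wo] wo_rel.ANTISYM[OF wo]
    unfolding underS_def by (blast dest: transD antisymD)
  then show "|S| <o \<kappa>"
    using card_of_underS[OF card c(1)] card_of_mono1 ordLeq_ordLess_trans by blast
next
  have wo: "wo_rel \<kappa>" using card by (simp add: wo_rel_def card_order_on_def)
  assume small: "|S| <o \<kappa>"
  show "\<exists>b\<in>Field \<kappa>. \<forall>s\<in>S. (s, b) \<in> \<kappa>"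
  proof (rule ccontr)
    assume unb: "\<not> ?thesis"
    have "cofinal S \<kappa>"
      unfolding cofinal_def
    proof
      fix a assume a: "a \<in> Field \<kappa>"
      then obtain s where s: "s \<in> S" "(s, a) \<notin> \<kappa>" using unb by blast
      then show "\<exists>b\<in>S. a \<noteq> b \<and> (a, b) \<in> \<kappa>" using wo_rel.TOTALS[OF wo] a S by (metis subsetD)
    qed
    then have "|S| =o \<kappa>" using reg S by (simp add: regularCard_def)
    then show False using small not_ordLess_ordIso by blast
  qed
qed

text \<open>
  Property (A) may return \<open>\<eta> = \<xi>\<close>.  One further bonding arrow makes the index increase strictly, as the
  order of links demands.
\<close>

lemma fraisse_absorb_strictly:
  assumes cat: "category C" and card: "Card_order \<kappa>" and inf: "infinite (Field \<kappa>)"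
    and u: "fraisse_seq C \<kappa> u" and \<xi>: "\<xi> \<in> Field \<kappa>" and f: "f \<in> homset C (ob u \<xi>) y"
  obtains \<eta> g where "\<eta> \<in> Field \<kappa>" "\<xi> \<noteq> \<eta>" "(\<xi>, \<eta>) \<in> \<kappa>" "g \<in> homset C y (ob u \<eta>)"
    "g \<bullet>\<^bsub>C\<^esub> f = bond u (\<xi>, \<eta>)"
proof -
  have wo: "wo_rel \<kappa>" using card by (simp add: wo_rel_def card_order_on_def)
  have seq: "inductive_seq C \<kappa> u" and idx: "idx u = Field \<kappa>" using u by (auto simp: fraisse_seq_def)
  have "y \<in> Obj C" using f cat by (auto simp: homset_def category_def)
  then obtain \<zeta> g where z: "\<zeta> \<in> Field \<kappa>" "(\<xi>, \<zeta>) \<in> \<kappa>" and g: "g \<in> homset C y (ob u \<zeta>)"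
    "bond u (\<xi>, \<zeta>) = g \<bullet>\<^bsub>C\<^esub> f"
    using u \<xi> f unfolding fraisse_seq_def by metis
  obtain \<eta> where e: "\<eta> \<in> Field \<kappa>" "\<zeta> \<noteq> \<eta>" "(\<zeta>, \<eta>) \<in> \<kappa>"
    using infinite_Card_order_limit[OF card inf z(1)] by blast
  have b: "bond u (\<zeta>, \<eta>) \<in> homset C (ob u \<zeta>) (ob u \<eta>)"
    using bond_homset[OF seq] z e idx by simp
  have o: "(\<xi>, \<eta>) \<in> \<kappa>" "\<xi> \<noteq> \<eta>"
    using z e wo_rel.TRANS[OF wo] wo_rel.ANTISYM[OF wo] by (blast dest: transD antisymD)+
  have "(bond u (\<zeta>, \<eta>) \<bullet>\<^bsub>C\<^esub> g) \<bullet>\<^bsub>C\<^esub> f = bond u (\<xi>, \<eta>)"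
    using Comp_assoc[OF cat f g(1) b] g(2) bond_bond[OF seq _ _ _ z(2) e(3)] idx \<xi> z(1) e(1) by simp
  then show thesis using that e(1) o Comp_homset[OF cat g(1) b] by blast
qed

locale fraisse_pair = sequence_pair C \<kappa> u v
  for C :: "('o, 'a) cat" and \<kappa> :: "'k rel" and u v :: "('k, 'o, 'a) seq" +
  fixes L :: "('k, 'o, 'a) qlim"
  assumes card: "Card_order \<kappa>" and infinite: "infinite (Field \<kappa>)" and regular: "regularCard \<kappa>"
    and lim: "partial_quasi_limiting C \<kappa> L"
    and u_fraisse: "fraisse_seq C \<kappa> u" and u_cont: "qlim_continuous \<kappa> L u"
    and v_fraisse: "fraisse_seq C \<kappa> v" and v_cont: "qlim_continuous \<kappa> L v"
begin

notation prec (infix \<open>\<prec>\<close> 50)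


lemma idx_uv: "idx u = Field \<kappa>" "idx v = Field \<kappa>"
  using u_fraisse v_fraisse by (auto simp: fraisse_seq_def)

lemma link_extend:
  assumes t: "t \<in> links"
  obtains t' where "t' \<in> links" "t \<prec> t'"
proof -
  obtain \<alpha> g where a: "\<alpha> \<in> Field \<kappa>" "src t \<noteq> \<alpha>" "(src t, \<alpha>) \<in> \<kappa>"
    and g: "g \<in> homset C (ob v (tgt t)) (ob u \<alpha>)" "g \<bullet>\<^bsub>C\<^esub> arr t = bond u (src t, \<alpha>)"
    using fraisse_absorb_strictly[OF cat card infinite u_fraisse _ linkD(3)[OF t]] linkD(1)[OF t] idx_uv
    by metis
  obtain \<beta> f where b: "\<beta> \<in> Field \<kappa>" "tgt t \<noteq> \<beta>" "(tgt t, \<beta>) \<in> \<kappa>"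
    and f: "f \<in> homset C (ob u \<alpha>) (ob v \<beta>)" "f \<bullet>\<^bsub>C\<^esub> g = bond v (tgt t, \<beta>)"
    using fraisse_absorb_strictly[OF cat card infinite v_fraisse _ g(1)] linkD(2)[OF t] idx_uv
    by metis
  show thesis
    by (rule that[of "Link \<alpha> \<beta> f"]) (use a b f g idx_uv in \<open>auto simp: links_def prec_def\<close>)
qed

text \<open>
  The limit stage of the back-and-forth construction: the new link is the value of the quasi-limiting
  operator at the isomorphism of initial segments given by the chain.  Its compatibility with the legs
  of the co-cones, which are bonding arrows by continuity, yields a commuting square from each
  link of the chain.  The arrow back from \<open>t\<close> to the limit comes from the arrow back to a later link of
  the chain.
\<close>

lemma link_limit:
  assumes T: "T \<subseteq> links" "T \<noteq> {}"
    and chain: "\<And>s t. s \<in> T \<Longrightarrow> t \<in> T \<Longrightarrow> s = t \<or> s \<prec> t \<or> t \<prec> s"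
    and no_max: "\<And>t. t \<in> T \<Longrightarrow> \<exists>s\<in>T. t \<prec> s"
    and bdd_src: "a \<in> Field \<kappa>" "\<And>t. t \<in> T \<Longrightarrow> (src t, a) \<in> \<kappa>"
    and bdd_tgt: "b \<in> Field \<kappa>" "\<And>t. t \<in> T \<Longrightarrow> (tgt t, b) \<in> \<kappa>"
  obtains t' where "t' \<in> links" "\<And>t. t \<in> T \<Longrightarrow> t \<prec> t'"
proof -
  have link: "t \<in> links" if "t \<in> T" for t using T(1) that by blast
  obtain \<delta> where \<delta>: "limit_ord \<kappa> \<delta>" "underS \<kappa> \<delta> = {\<xi>. \<exists>s\<in>src ` T. (\<xi>, s) \<in> \<kappa>}"
  proof (rule limit_sup[OF wo, of "src ` T" a])
    show "\<exists>t\<in>src ` T. s \<noteq> t \<and> (s, t) \<in> \<kappa>" if "s \<in> src ` T" for s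
      using that no_max unfolding prec_def by blast
  qed (use T bdd_src idx_uv linkD(1) in auto)
  obtain \<epsilon> where \<epsilon>: "limit_ord \<kappa> \<epsilon>" "underS \<kappa> \<epsilon> = {\<xi>. \<exists>s\<in>tgt ` T. (\<xi>, s) \<in> \<kappa>}"
  proof (rule limit_sup[OF wo, of "tgt ` T" b])
    show "\<exists>t\<in>tgt ` T. s \<noteq> t \<and> (s, t) \<in> \<kappa>" if "s \<in> tgt ` T" for s
      using that no_max unfolding prec_def by blast
  qed (use T bdd_tgt idx_uv linkD(2) in auto)
  let ?u = "restrict_seq \<kappa> u \<delta>" and ?v = "restrict_seq \<kappa> v \<epsilon>"
  have dF: "\<delta> \<in> Field \<kappa>" "\<epsilon> \<in> Field \<kappa>" using \<delta>(1) \<epsilon>(1) by (auto simp: limit_ord_def)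
  have u\<delta>: "?u \<in> qdom L" "ob u \<delta> = qapex L ?u" "\<And>\<xi>. \<xi> \<in> underS \<kappa> \<delta> \<Longrightarrow> bond u (\<xi>, \<delta>) = qleg L ?u \<xi>"
    using u_cont dF(1) \<delta>(1) idx_uv(1) by (auto simp: qlim_continuous_def)
  have v\<epsilon>: "?v \<in> qdom L" "ob v \<epsilon> = qapex L ?v" "\<And>\<xi>. \<xi> \<in> underS \<kappa> \<epsilon> \<Longrightarrow> bond v (\<xi>, \<epsilon>) = qleg L ?v \<xi>"
    using v_cont dF(2) \<epsilon>(1) idx_uv(2) by (auto simp: qlim_continuous_def)
  interpret R: sequence_pair C \<kappa> ?u ?v
    using well_order cat lim u\<delta>(1) v\<epsilon>(1)
    by unfold_locales (auto simp: partial_quasi_limiting_def small_seqs_def)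
  have idx: "idx ?u = underS \<kappa> \<delta>" "idx ?v = underS \<kappa> \<epsilon>" by (simp_all add: restrict_seq_def)
  have in_idx: "src t \<in> underS \<kappa> \<delta>" "tgt t \<in> underS \<kappa> \<epsilon>" if "t \<in> T" for t
    using that linkD(1,2)[OF link[OF that]] idx_refl unfolding \<delta>(2) \<epsilon>(2) by blast+
  have ob: "ob ?u \<xi> = ob u \<xi>" if "\<xi> \<in> underS \<kappa> \<delta>" for \<xi> using that by (simp add: restrict_seq_def)
  have ob': "ob ?v \<xi> = ob v \<xi>" if "\<xi> \<in> underS \<kappa> \<epsilon>" for \<xi> using that by (simp add: restrict_seq_def)
  have bond: "bond ?u (\<xi>, \<eta>) = bond u (\<xi>, \<eta>)"
    if "\<xi> \<in> underS \<kappa> \<delta>" "\<eta> \<in> underS \<kappa> \<delta>" "(\<xi>, \<eta>) \<in> \<kappa>" for \<xi> \<eta>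
    using that by (simp add: restrict_seq_def)
  have bond': "bond ?v (\<xi>, \<eta>) = bond v (\<xi>, \<eta>)"
    if "\<xi> \<in> underS \<kappa> \<epsilon>" "\<eta> \<in> underS \<kappa> \<epsilon>" "(\<xi>, \<eta>) \<in> \<kappa>" for \<xi> \<eta>
    using that by (simp add: restrict_seq_def)
  have R_prec: "R.prec s t" if "s \<in> T" "t \<in> T" "s \<prec> t" for s t
    using that in_idx[OF that(1)] in_idx[OF that(2)]
    by (auto simp: R.prec_def prec_def ob ob' bond bond')
  obtain \<phi> F where h: "(\<phi>, F) \<in> transformations C \<kappa> ?u ?v"
    "trans_class C \<kappa> ?u ?v (\<phi>, F) \<in> seq_isos C \<kappa> ?u ?v"
    "\<And>t. t \<in> T \<Longrightarrow> \<phi> (src t) = tgt t \<and> F (src t) = arr t"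
  proof (rule R.cofinal_chain_iso[of T])
    show "T \<subseteq> R.links"
      using in_idx linkD(3) link by (auto simp: R.links_def idx ob ob')
    show "\<And>s t. s \<in> T \<Longrightarrow> t \<in> T \<Longrightarrow> s = t \<or> R.prec s t \<or> R.prec t s"
      using chain R_prec by blast
    show "\<And>t. t \<in> T \<Longrightarrow> \<exists>s\<in>T. R.prec t s" using no_max R_prec by blast
  qed (auto simp: idx \<delta>(2) \<epsilon>(2))
  let ?h = "trans_class C \<kappa> ?u ?v (\<phi>, F)"
  have rep: "(\<phi>, F) \<in> ?h"
    using equiv_class_self[OF equiv_trans_equiv[OF well_order cat R.x_seq R.y_seq] h(1)]
    by (simp add: trans_class_def)
  define m where "m = qmor L ?u ?v ?h"
  have "m \<in> isos C (qapex L ?u) (qapex L ?v) \<and>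
      (\<forall>(\<phi>, F)\<in>?h. \<forall>\<xi>\<in>idx ?u. m \<bullet>\<^bsub>C\<^esub> qleg L ?u \<xi> = qleg L ?v (\<phi> \<xi>) \<bullet>\<^bsub>C\<^esub> F \<xi>)"
    using lim u\<delta>(1) v\<epsilon>(1) h(2) unfolding partial_quasi_limiting_def m_def by blast
  then have m: "m \<in> homset C (ob u \<delta>) (ob v \<epsilon>)"
    and m_leg: "\<And>\<xi>. \<xi> \<in> idx ?u \<Longrightarrow> m \<bullet>\<^bsub>C\<^esub> qleg L ?u \<xi> = qleg L ?v (\<phi> \<xi>) \<bullet>\<^bsub>C\<^esub> F \<xi>"
    using rep u\<delta>(2) v\<epsilon>(2) by (auto simp: isos_def)
  have square: "m \<bullet>\<^bsub>C\<^esub> bond u (src t, \<delta>) = bond v (tgt t, \<epsilon>) \<bullet>\<^bsub>C\<^esub> arr t" if "t \<in> T" for t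
    using m_leg[of "src t"] h(3)[OF that] in_idx[OF that] u\<delta>(3) v\<epsilon>(3) idx by auto
  have M: "Link \<delta> \<epsilon> m \<in> links" using m dF idx_uv by (simp add: links_def)
  show thesis
  proof (rule that[OF M])
    fix t assume t: "t \<in> T"
    then obtain s where s: "s \<in> T" "t \<prec> s" using no_max by blast
    then show "t \<prec> Link \<delta> \<epsilon> m"
      using prec_square[OF link[OF t] link[OF s(1)] M s(2)] square[OF s(1)] in_idx[OF s(1)]
      by (auto simp: underS_def)
  qed
qed

text \<open>
  Maximality takes the place of transfinite recursion.  A link that continues all members of a maximal
  chain would have to be a member; \<open>link_extend\<close> at a largest element, or \<open>link_limit\<close> when there is
  none, would produce such a link if the chain were bounded on both sides.
\<close>

lemma cofinal_chain_above:
  assumes t0: "t0 \<in> links"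
  obtains T where "T \<subseteq> links" "t0 \<in> T"
    "\<And>s t. s \<in> T \<Longrightarrow> t \<in> T \<Longrightarrow> s = t \<or> s \<prec> t \<or> t \<prec> s"
    "\<And>t. t \<in> T \<Longrightarrow> \<exists>s\<in>T. t \<prec> s"
    "\<And>\<xi>. \<xi> \<in> Field \<kappa> \<Longrightarrow> \<exists>t\<in>T. (\<xi>, src t) \<in> \<kappa>"
    "\<And>\<eta>. \<eta> \<in> Field \<kappa> \<Longrightarrow> \<exists>t\<in>T. (\<eta>, tgt t) \<in> \<kappa>"
proof -
  \<comment> \<open>All elements of \<open>A\<close> are comparable with \<open>t0\<close>, which therefore lies in every maximal chain.\<close>
  define A where "A = {t \<in> links. t = t0 \<or> t0 \<prec> t}"
  obtain T where "pred_on.maxchain A prec T" using pred_on.Hausdorff by blast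
  then have ch: "pred_on.chain A prec T" and max: "\<And>S. pred_on.chain A prec S \<Longrightarrow> \<not> T \<subset> S"
    by (auto simp: pred_on.maxchain_def)
  have TA: "T \<subseteq> A" using ch by (simp add: pred_on.chain_def)
  then have link: "t \<in> links" if "t \<in> T" for t using that by (auto simp: A_def)
  have chain: "s = t \<or> s \<prec> t \<or> t \<prec> s" if "s \<in> T" "t \<in> T" for s t
    using pred_on.chain_total[OF ch that] by auto
  have insert_chain: "t \<in> T" if t: "t \<in> A" and c: "\<And>s. s \<in> T \<Longrightarrow> s = t \<or> s \<prec> t \<or> t \<prec> s" for t
  proof (rule ccontr)
    assume "t \<notin> T"
    moreover have "pred_on.chain A prec (insert t T)"
      unfolding pred_on.chain_def using TA t c chain by blast
    ultimately show False using max[of "insert t T"] by blast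
  qed
  have t0T: "t0 \<in> T"
    by (rule insert_chain) (use t0 TA in \<open>auto simp: A_def\<close>)
  have no_upper: False if t: "t \<in> links" and up: "\<And>s. s \<in> T \<Longrightarrow> s \<prec> t" for t
  proof -
    have "t \<in> T"
      by (rule insert_chain) (use t up[OF t0T] up in \<open>auto simp: A_def\<close>)
    then show False using up[of t] by (simp add: prec_def)
  qed
  have no_max: "\<exists>s\<in>T. t \<prec> s" if t: "t \<in> T" for t
  proof (rule ccontr)
    assume top: "\<not> ?thesis"
    obtain t' where t': "t' \<in> links" "t \<prec> t'" using link_extend[OF link[OF t]] .
    show False
    proof (rule no_upper[OF t'(1)])
      fix s assume s: "s \<in> T"
      then have "s = t \<or> s \<prec> t" using chain[OF s t] top by blast
      then show "s \<prec> t'" using t' prec_trans[OF link[OF s] link[OF t] t'(1)] by blast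
    qed
  qed
  have sub: "src ` T \<subseteq> Field \<kappa>" "tgt ` T \<subseteq> Field \<kappa>"
    using link linkD(1,2) idx_uv by auto
  have inj: "inj_on src T" "inj_on tgt T"
  proof -
    have "src s \<noteq> src t" "tgt s \<noteq> tgt t" if "s \<in> T" "t \<in> T" "s \<noteq> t" for s t
      using chain[OF that(1,2)] that(3) unfolding prec_def by metis+
    then show "inj_on src T" "inj_on tgt T" unfolding inj_on_def by blast+
  qed
  \<comment> \<open>Different members of a chain differ in source and in target, so either set has the size of \<open>T\<close>.\<close>
  have eqcard: "|src ` T| =o |tgt ` T|"
    using inj inj_on_imp_bij_betw card_of_ordIsoI ordIso_symmetric ordIso_transitive by metis
  let ?bdd = "\<lambda>S. \<exists>b\<in>Field \<kappa>. \<forall>s\<in>S. (s, b) \<in> \<kappa>"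
  have same: "?bdd (src ` T) \<longleftrightarrow> ?bdd (tgt ` T)"
    unfolding bounded_iff_card_less[OF card infinite regular sub(1)]
      bounded_iff_card_less[OF card infinite regular sub(2)]
    using eqcard ordIso_symmetric ordIso_ordLess_trans by blast
  have "\<not> (?bdd (src ` T) \<and> ?bdd (tgt ` T))"
  proof
    assume "?bdd (src ` T) \<and> ?bdd (tgt ` T)"
    then obtain a b where ab: "a \<in> Field \<kappa>" "\<forall>s\<in>src ` T. (s, a) \<in> \<kappa>"
      "b \<in> Field \<kappa>" "\<forall>s\<in>tgt ` T. (s, b) \<in> \<kappa>" by (elim conjE bexE)
    have "T \<subseteq> links" "T \<noteq> {}" using link t0T by auto
    then obtain t where "t \<in> links" "\<And>s. s \<in> T \<Longrightarrow> s \<prec> t"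
      using link_limit[OF _ _ chain no_max ab(1) _ ab(3)] ab(2,4) by auto
    then show False by (rule no_upper)
  qed
  then have "\<not> ?bdd (src ` T)" "\<not> ?bdd (tgt ` T)" using same by blast+
  then have cof: "\<exists>t\<in>T. (\<xi>, src t) \<in> \<kappa>" "\<exists>t\<in>T. (\<xi>, tgt t) \<in> \<kappa>" if "\<xi> \<in> Field \<kappa>" for \<xi>
    using that ord_total sub by (metis image_eqI imageE subsetD)+
  have TL: "T \<subseteq> links" using link by blast
  show thesis
    by (rule that[OF TL t0T chain no_max cof])
qed

lemma iso_extending_link:
  assumes t0: "t0 \<in> links"
  obtains \<phi> F where "(\<phi>, F) \<in> transformations C \<kappa> u v"
    "trans_class C \<kappa> u v (\<phi>, F) \<in> seq_isos C \<kappa> u v"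
    "\<phi> (src t0) = tgt t0" "F (src t0) = arr t0"
proof (rule cofinal_chain_above[OF t0])
  fix T
  assume T: "T \<subseteq> links" "t0 \<in> T"
    "\<And>s t. s \<in> T \<Longrightarrow> t \<in> T \<Longrightarrow> s = t \<or> s \<prec> t \<or> t \<prec> s"
    "\<And>t. t \<in> T \<Longrightarrow> \<exists>s\<in>T. t \<prec> s"
    "\<And>\<xi>. \<xi> \<in> Field \<kappa> \<Longrightarrow> \<exists>t\<in>T. (\<xi>, src t) \<in> \<kappa>"
    "\<And>\<eta>. \<eta> \<in> Field \<kappa> \<Longrightarrow> \<exists>t\<in>T. (\<eta>, tgt t) \<in> \<kappa>"
  show thesis
    by (rule cofinal_chain_iso[OF T(1,3,4)]) (use T(2,5,6) idx_uv that in auto)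
qed

end

lemma obj_seq_inductive:
  assumes wo: "wo_rel \<kappa>" and cat: "category C" and ne: "Field \<kappa> \<noteq> {}" and a: "a \<in> Obj C"
  shows "inductive_seq C \<kappa> (obj_seq C \<kappa> a)"
proof -
  let ?z = "ord_zero \<kappa>"
  have z: "?z \<in> Field \<kappa>" "\<And>b. b \<in> Field \<kappa> \<Longrightarrow> (?z, b) \<in> \<kappa>"
    using wo_rel.minim_in[OF wo subset_refl ne] wo_rel.minim_least[OF wo subset_refl]
    by (auto simp: ord_zero_def)
  have "ofilter \<kappa> {?z}"
    unfolding Order_Relation.ofilter_def Order_Relation.under_def
    using z wo_rel.ANTISYM[OF wo] by (auto simp: Field_def dest: antisymD)
  moreover have id: "Ident C a \<in> homset C a a"
    using cat a by (simp add: category_def)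
  moreover have "Ident C a \<bullet>\<^bsub>C\<^esub> Ident C a = Ident C a"
    using cat id unfolding category_def homset_def by fastforce
  moreover have "(?z, ?z) \<in> \<kappa>" using z by blast
  ultimately show ?thesis
    using a by (auto simp: inductive_seq_def obj_seq_def)
qed

theorem theorem4p4:
  fixes \<kappa> :: "'k rel"
    and C :: "('o, 'a) cat"
    and L :: "('k, 'o, 'a) qlim"
    and u v :: "('k, 'o, 'a) seq"
  assumes "Card_order \<kappa>" and "natLeq <o \<kappa>" and "regularCard \<kappa>"
    and "category C"
    and "partial_quasi_limiting C \<kappa> L"
    and "fraisse_seq C \<kappa> u" and "qlim_continuous \<kappa> L u"
    and "fraisse_seq C \<kappa> v" and "qlim_continuous \<kappa> L v"
  shows "\<forall>\<alpha>\<in>Field \<kappa>. \<forall>f\<in>seq_homset C \<kappa> (obj_seq C \<kappa> (ob u \<alpha>)) v.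
           \<exists>h\<in>seq_isos C \<kappa> u v.
             seq_comp C \<kappa> (obj_seq C \<kappa> (ob u \<alpha>)) v h (seq_inj C \<kappa> u \<alpha>) = f"
proof (intro ballI)
  fix \<alpha> f
  assume \<alpha>: "\<alpha> \<in> Field \<kappa>" and f: "f \<in> seq_homset C \<kappa> (obj_seq C \<kappa> (ob u \<alpha>)) v"
  have inf: "infinite (Field \<kappa>)"
    using assms(1,2) ordLess_imp_ordLeq infinite_iff_natLeq_ordLeq card_of_Field_ordIso
      ordIso_symmetric ordLeq_ordIso_trans by metis
  interpret fraisse_pair C \<kappa> u v L
    using assms inf by unfold_locales (auto simp: card_order_on_def fraisse_seq_def)
  let ?z = "ord_zero \<kappa>" and ?o = "obj_seq C \<kappa> (ob u \<alpha>)"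
  have uh: "Ident C (ob u \<alpha>) \<in> homset C (ob u \<alpha>) (ob u \<alpha>)" "ob u \<alpha> \<in> Obj C"
    using x_bond[of \<alpha> \<alpha>] bond_refl(1)[of \<alpha>] hom_ob idx_uv \<alpha> idx_refl(1)[of \<alpha>] by auto
  have o_seq: "inductive_seq C \<kappa> ?o"
    by (rule obj_seq_inductive[OF wo cat _ uh(2)]) (use \<alpha> in auto)
  obtain \<psi> H where t: "(\<psi>, H) \<in> transformations C \<kappa> ?o v" and f_eq: "f = trans_class C \<kappa> ?o v (\<psi>, H)"
    using f by (auto simp: seq_homset_def trans_class_def elim!: quotientE)
  have link: "Link \<alpha> (\<psi> ?z) (H ?z) \<in> links"
    using t \<alpha> idx_uv by (auto simp: links_def transformations_def obj_seq_def)
  obtain \<phi> F where h: "(\<phi>, F) \<in> transformations C \<kappa> u v"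
    "trans_class C \<kappa> u v (\<phi>, F) \<in> seq_isos C \<kappa> u v" "\<phi> \<alpha> = \<psi> ?z" "F \<alpha> = H ?z"
    using iso_extending_link[OF link] by auto
  let ?i = "(\<lambda>_\<in>{?z}. \<alpha>, \<lambda>_\<in>{?z}. Ident C (ob u \<alpha>))"
  have i: "?i \<in> transformations C \<kappa> ?o u"
    using uh comp_id[OF uh(1)] \<alpha> idx_uv idx_refl(1)[of \<alpha>] bond_refl(1)[of \<alpha>]
    by (auto simp: transformations_def obj_seq_def)
  have "H ?z \<bullet>\<^bsub>C\<^esub> Ident C (ob u \<alpha>) = H ?z"
    using linkD(3)[OF link] comp_id by simp
  then have "trans_comp C ?o (\<phi>, F) ?i = (\<psi>, H)"
    using t h(3,4)
    by (auto simp: trans_comp_def obj_seq_def transformations_def fun_eq_iff PiE_iff extensional_def)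
  then have "seq_comp C \<kappa> ?o v (trans_class C \<kappa> u v (\<phi>, F)) (seq_inj C \<kappa> u \<alpha>) = f"
    using seq_comp_class[OF well_order cat o_seq x_seq y_seq i h(1)] by (simp add: seq_inj_def f_eq)
  then show "\<exists>h\<in>seq_isos C \<kappa> u v. seq_comp C \<kappa> ?o v h (seq_inj C \<kappa> u \<alpha>) = f"
    using h(2) by blast
qed

end
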